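(* Let $(\Omega^\bullet,\wedge,d,s)$ be a quasi-tame differential calculus on a unital algebra $B$, let $\psi_s:=1-s\circ\wedge:\Omega^1\otimes_B\Omega^1\to\Omega^1\otimes_B\Omega^1$, and let $\nabla:\Omega^1\to\Omega^1\otimes_B\Omega^1$ be a (left) connection on $\Omega^1$. Then the following statements are equivalent: (i) $\wedge\circ\nabla=d$ as maps $\Omega^1\to\Omega^2$. (ii) $(1-\psi_s)\circ\nabla=d_{\psi_s}$, where $d_{\psi_s}:\Omega^1\to\Omega^1\otimes_B\Omega^1$ is the map associated with the weak second order differential structure $(\Omega^1,d,\psi_s)$.
   Context: Algebras are unital over $\mathbb{C}$. A differential calculus on $B$ is a differential graded algebra $(\Omega^\bullet=\bigoplus_{k\ge0}\Omega^k,\wedge,d)$ with $\Omega^0=B$, generated as an algebra by $B$ and $dB$; $\wedge$ also denotes the induced $B$-bimodule map $\Omega^1\otimes_B\Omega^1\to\Omega^2$. A (left) connection on $\Omega^1$ is a $\mathbb{C}$-linear map $\nabla:\Omega^1\to\Omega^1\otimes_B\Omega^1$ with $\nabla(b\omega)=b\nabla(\omega)+db\otimes_B\omega$. A quasi-tame differential calculus $(\Omega^\bullet,\wedge,d,s)$ is a differential calculus such that $\Omega^1$ is finitely generated projective as a left $B$-module, together with a $B$-bilinear map $s:\Omega^2\to\Omega^1\otimes_B\Omega^1$ with $\wedge\circ s=\mathrm{id}_{\Omega^2}$. Universal forms: $\Omega^1_u$ is the kernel of the multiplication $B\otimes B\to B$, $\delta(b)=1\otimes b-b\otimes1$, $\Omega^k_u$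 is the $k$-fold tensor power of $\Omega^1_u$ over $B$, and $\delta(b_0\delta(b_1)\cdots\delta(b_k))=\delta(b_0)\delta(b_1)\cdots\delta(b_k)$. The map $\pi:\Omega^1_u\to\Omega^1$ is the surjective bimodule map $b_0\delta(b_1)\mapsto b_0db_1$, and $\widehat\pi$ is in degree $2$ the map $\Omega^2_u\to\Omega^1\otimes_B\Omega^1$, $b_0\delta(b_1)\delta(b_2)\mapsto b_0db_1\otimes_Bdb_2$. Set $JT^2_d=\{\widehat\pi(\delta(\omega)):\omega\in\Omega^1_u,\ \pi(\omega)=0\}$. A weak second order differential structure is a triple $(\Omega^1,d,\psi)$ with $(\Omega^1,d)$ a first order differential calculus ($\Omega^1$ a $B$-bimodule, $d:B\to\Omega^1$ a derivation, $\Omega^1=\mathrm{span}\{b\,dc\}$) and $\psi$ a $B$-bilinear idempotent on $\Omega^1\otimes_B\Omega^1$ with $JT^2_d\subseteq\mathrm{Ran}(\psi)$; then $d_\psi:\Omega^1\to\Omega^1\otimes_B\Omega^1$ is the well-defined map $d_\psi(\omega)=(1-\psi)\big(\widehat\pi(\delta(\tilde\omega))\big)$ for any $\tilde\omega\in\Omega^1_u$ with $\pi(\tilde\omega)=\omega$. (It is known that $(\Omega^1,d,\psi_s)$ is a weak second order differential structure.) *)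

theory Defs
  imports "HOL-Algebra.Free_Abelian_Groups" "HOL-Algebra.Subrings"
begin

section \<open>Complex algebras and bimodules\<close>

definition complex_ring :: "complex ring" where
  "complex_ring = \<lparr>carrier = UNIV, mult = (*), one = 1, zero = 0, add = (+)\<rparr>"

text \<open>The locale \<^locale>\<open>algebra\<close> of the library is restricted to commutative algebras, whence the
  following one.  The zero algebra is not excluded.\<close>

locale complex_algebra = ring A + module complex_ring A
  for A :: "(complex, 'a, 'x) module_scheme" (structure) +
  assumes smult_mult_left: "\<lbrakk>x \<in> carrier A; y \<in> carrier A\<rbrakk> \<Longrightarrow> (c \<odot> x) \<otimes> y = c \<odot> (x \<otimes> y)"
    and smult_mult_right: "\<lbrakk>x \<in> carrier A; y \<in> carrier A\<rbrakk> \<Longrightarrow> x \<otimes> (c \<odot> y) = c \<odot> (x \<otimes> y)"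

text \<open>As for \<^typ>\<open>('a, 'b) module\<close>, the fields \<^const>\<open>mult\<close> and \<^const>\<open>one\<close> of a
  bimodule are not used.\<close>

record ('a, 'm, 'c) bimodule = "('a, 'm) module" +
  rsmult :: "['m, 'c] \<Rightarrow> 'm" (infixl \<open>\<odot>\<^sub>r\<index>\<close> 70)

locale bimodule = L?: ring A + R?: ring C + M?: abelian_group M
  for A :: "('a, 'x) ring_scheme" and C :: "('c, 'y) ring_scheme"
    and M :: "('a, 'm, 'c, 'z) bimodule_scheme" +
  assumes lsmult_closed: "\<lbrakk>a \<in> carrier A; m \<in> carrier M\<rbrakk> \<Longrightarrow> a \<odot>\<^bsub>M\<^esub> m \<in> carrier M"
    and lsmult_add_left: "\<lbrakk>a \<in> carrier A; b \<in> carrier A; m \<in> carrier M\<rbrakk>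
      \<Longrightarrow> (a \<oplus>\<^bsub>A\<^esub> b) \<odot>\<^bsub>M\<^esub> m = a \<odot>\<^bsub>M\<^esub> m \<oplus>\<^bsub>M\<^esub> b \<odot>\<^bsub>M\<^esub> m"
    and lsmult_add_right: "\<lbrakk>a \<in> carrier A; m \<in> carrier M; n \<in> carrier M\<rbrakk>
      \<Longrightarrow> a \<odot>\<^bsub>M\<^esub> (m \<oplus>\<^bsub>M\<^esub> n) = a \<odot>\<^bsub>M\<^esub> m \<oplus>\<^bsub>M\<^esub> a \<odot>\<^bsub>M\<^esub> n"
    and lsmult_assoc: "\<lbrakk>a \<in> carrier A; b \<in> carrier A; m \<in> carrier M\<rbrakk>
      \<Longrightarrow> (a \<otimes>\<^bsub>A\<^esub> b) \<odot>\<^bsub>M\<^esub> m = a \<odot>\<^bsub>M\<^esub> (b \<odot>\<^bsub>M\<^esub> m)"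
    and lsmult_one: "m \<in> carrier M \<Longrightarrow> \<one>\<^bsub>A\<^esub> \<odot>\<^bsub>M\<^esub> m = m"
    and rsmult_closed: "\<lbrakk>m \<in> carrier M; c \<in> carrier C\<rbrakk> \<Longrightarrow> m \<odot>\<^sub>r\<^bsub>M\<^esub> c \<in> carrier M"
    and rsmult_add_left: "\<lbrakk>m \<in> carrier M; n \<in> carrier M; c \<in> carrier C\<rbrakk>
      \<Longrightarrow> (m \<oplus>\<^bsub>M\<^esub> n) \<odot>\<^sub>r\<^bsub>M\<^esub> c = m \<odot>\<^sub>r\<^bsub>M\<^esub> c \<oplus>\<^bsub>M\<^esub> n \<odot>\<^sub>r\<^bsub>M\<^esub> c"
    and rsmult_add_right: "\<lbrakk>m \<in> carrier M; c \<in> carrier C; e \<in> carrier C\<rbrakk>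
      \<Longrightarrow> m \<odot>\<^sub>r\<^bsub>M\<^esub> (c \<oplus>\<^bsub>C\<^esub> e) = m \<odot>\<^sub>r\<^bsub>M\<^esub> c \<oplus>\<^bsub>M\<^esub> m \<odot>\<^sub>r\<^bsub>M\<^esub> e"
    and rsmult_assoc: "\<lbrakk>m \<in> carrier M; c \<in> carrier C; e \<in> carrier C\<rbrakk>
      \<Longrightarrow> m \<odot>\<^sub>r\<^bsub>M\<^esub> (c \<otimes>\<^bsub>C\<^esub> e) = (m \<odot>\<^sub>r\<^bsub>M\<^esub> c) \<odot>\<^sub>r\<^bsub>M\<^esub> e"
    and rsmult_one: "m \<in> carrier M \<Longrightarrow> m \<odot>\<^sub>r\<^bsub>M\<^esub> \<one>\<^bsub>C\<^esub> = m"
    and lsmult_rsmult: "\<lbrakk>a \<in> carrier A; m \<in> carrier M; c \<in> carrier C\<rbrakk>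
      \<Longrightarrow> (a \<odot>\<^bsub>M\<^esub> m) \<odot>\<^sub>r\<^bsub>M\<^esub> c = a \<odot>\<^bsub>M\<^esub> (m \<odot>\<^sub>r\<^bsub>M\<^esub> c)"

text \<open>A bimodule over a complex algebra is always understood to carry one complex vector space
  structure, i.e. the scalars act in the same way from both sides.\<close>

locale complex_bimodule = complex_algebra B + bimodule B B M
  for B :: "(complex, 'b, 'x) module_scheme" and M :: "('b, 'm, 'b, 'z) bimodule_scheme" +
  assumes scalars_central: "m \<in> carrier M
    \<Longrightarrow> (c \<odot>\<^bsub>B\<^esub> \<one>\<^bsub>B\<^esub>) \<odot>\<^bsub>M\<^esub> m = m \<odot>\<^sub>r\<^bsub>M\<^esub> (c \<odot>\<^bsub>B\<^esub> \<one>\<^bsub>B\<^esub>)"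

definition cscale :: "(complex, 'b, 'x) module_scheme \<Rightarrow> ('b, 'm, 'z) module_scheme
    \<Rightarrow> complex \<Rightarrow> 'm \<Rightarrow> 'm" where
  "cscale B M c m = (c \<odot>\<^bsub>B\<^esub> \<one>\<^bsub>B\<^esub>) \<odot>\<^bsub>M\<^esub> m"

definition left_hom :: "('a, 'x) ring_scheme \<Rightarrow> ('a, 'm, 'y) module_scheme
    \<Rightarrow> ('a, 'n, 'z) module_scheme \<Rightarrow> ('m \<Rightarrow> 'n) set" where
  "left_hom A M N = {f \<in> carrier M \<rightarrow> carrier N.
     (\<forall>m \<in> carrier M. \<forall>m' \<in> carrier M. f (m \<oplus>\<^bsub>M\<^esub> m') = f m \<oplus>\<^bsub>N\<^esub> f m') \<and>
     (\<forall>a \<in> carrier A. \<forall>m \<in> carrier M. f (a \<odot>\<^bsub>M\<^esub> m) = a \<odot>\<^bsub>N\<^esub> f m)}"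

definition bimodule_hom :: "('a, 'x) ring_scheme \<Rightarrow> ('c, 'u) ring_scheme
    \<Rightarrow> ('a, 'm, 'c, 'y) bimodule_scheme \<Rightarrow> ('a, 'n, 'c, 'z) bimodule_scheme \<Rightarrow> ('m \<Rightarrow> 'n) set" where
  "bimodule_hom A C M N = {f \<in> left_hom A M N.
     \<forall>m \<in> carrier M. \<forall>c \<in> carrier C. f (m \<odot>\<^sub>r\<^bsub>M\<^esub> c) = f m \<odot>\<^sub>r\<^bsub>N\<^esub> c}"

definition free_left_module :: "('a, 'x) ring_scheme \<Rightarrow> nat \<Rightarrow> ('a, nat \<Rightarrow> 'a) module" where
  "free_left_module A n = \<lparr>carrier = {..<n} \<rightarrow>\<^sub>E carrier A, mult = undefined, one = undefined,
     zero = (\<lambda>i\<in>{..<n}. \<zero>\<^bsub>A\<^esub>), add = (\<lambda>v w. \<lambda>i\<in>{..<n}. v i \<oplus>\<^bsub>A\<^esub> w i),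
     smult = (\<lambda>a v. \<lambda>i\<in>{..<n}. a \<otimes>\<^bsub>A\<^esub> v i)\<rparr>"

text \<open>A finitely generated projective left module is a direct summand of some \<open>A\<^sup>n\<close>; the
  projection \<open>p\<close> and the inclusion \<open>i\<close> are made explicit.\<close>

definition fg_projective :: "('a, 'x) ring_scheme \<Rightarrow> ('a, 'm, 'y) module_scheme \<Rightarrow> bool" where
  "fg_projective A M \<longleftrightarrow> (\<exists>n. \<exists>p \<in> left_hom A (free_left_module A n) M.
     \<exists>i \<in> left_hom A M (free_left_module A n). \<forall>m \<in> carrier M. p (i m) = m)"


section \<open>Tensor products over a noncommutative ring\<close>

text \<open>The tensor product of a right \<open>R\<close>-module \<open>M\<close> and a left \<open>R\<close>-module \<open>N\<close> is the quotient of the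
  free abelian group on \<open>carrier M \<times> carrier N\<close> by biadditivity and \<open>R\<close>-balancedness.
  Its elements are cosets.\<close>

definition tensor_free :: "('a, 'm, 'r, 'x) bimodule_scheme \<Rightarrow> ('r, 'n, 'c, 'y) bimodule_scheme
    \<Rightarrow> ('m \<times> 'n \<Rightarrow>\<^sub>0 int) monoid" where
  "tensor_free M N = free_Abelian_group (carrier M \<times> carrier N)"

definition tensor_relations :: "('r, 'z) ring_scheme \<Rightarrow> ('a, 'm, 'r, 'x) bimodule_scheme
    \<Rightarrow> ('r, 'n, 'c, 'y) bimodule_scheme \<Rightarrow> ('m \<times> 'n \<Rightarrow>\<^sub>0 int) set" where
  "tensor_relations R M N =
     {frag_of (m \<oplus>\<^bsub>M\<^esub> m', n) - frag_of (m, n) - frag_of (m', n) | m m' n.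
        m \<in> carrier M \<and> m' \<in> carrier M \<and> n \<in> carrier N} \<union>
     {frag_of (m, n \<oplus>\<^bsub>N\<^esub> n') - frag_of (m, n) - frag_of (m, n') | m n n'.
        m \<in> carrier M \<and> n \<in> carrier N \<and> n' \<in> carrier N} \<union>
     {frag_of (m \<odot>\<^sub>r\<^bsub>M\<^esub> r, n) - frag_of (m, r \<odot>\<^bsub>N\<^esub> n) | m r n.
        m \<in> carrier M \<and> r \<in> carrier R \<and> n \<in> carrier N}"

definition tensor_null :: "('r, 'z) ring_scheme \<Rightarrow> ('a, 'm, 'r, 'x) bimodule_scheme
    \<Rightarrow> ('r, 'n, 'c, 'y) bimodule_scheme \<Rightarrow> ('m \<times> 'n \<Rightarrow>\<^sub>0 int) set" where
  "tensor_null R M N = generate (tensor_free M N) (tensor_relations R M N)"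

definition tensor :: "('r, 'z) ring_scheme \<Rightarrow> ('a, 'm, 'r, 'x) bimodule_scheme
    \<Rightarrow> ('r, 'n, 'c, 'y) bimodule_scheme \<Rightarrow> ('a, ('m \<times> 'n \<Rightarrow>\<^sub>0 int) set, 'c) bimodule" where
  "tensor R M N =
     \<lparr>carrier = carrier (tensor_free M N Mod tensor_null R M N),
      mult = undefined, one = undefined,
      zero = \<one>\<^bsub>tensor_free M N Mod tensor_null R M N\<^esub>,
      add = (\<otimes>\<^bsub>tensor_free M N Mod tensor_null R M N\<^esub>),
      smult = (\<lambda>a X. \<Union>x\<in>X. tensor_null R M N #>\<^bsub>tensor_free M N\<^esub>
                 frag_extend (\<lambda>(m, n). frag_of (a \<odot>\<^bsub>M\<^esub> m, n)) x),
      rsmult = (\<lambda>X c. \<Union>x\<in>X. tensor_null R M N #>\<^bsub>tensor_free M N\<^esub>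
                 frag_extend (\<lambda>(m, n). frag_of (m, n \<odot>\<^sub>r\<^bsub>N\<^esub> c)) x)\<rparr>"

definition pure_tensor :: "('r, 'z) ring_scheme \<Rightarrow> ('a, 'm, 'r, 'x) bimodule_scheme
    \<Rightarrow> ('r, 'n, 'c, 'y) bimodule_scheme \<Rightarrow> 'm \<Rightarrow> 'n \<Rightarrow> ('m \<times> 'n \<Rightarrow>\<^sub>0 int) set" where
  "pure_tensor R M N m n = tensor_null R M N #>\<^bsub>tensor_free M N\<^esub> frag_of (m, n)"

text \<open>The additive map into \<open>P\<close> that a balanced map \<open>f\<close> induces on a tensor product,
  \<open>m \<otimes> n \<mapsto> f m n\<close>; all representatives of a coset give the same value.\<close>

definition tensor_lift :: "('p, 'x) ring_scheme \<Rightarrow> ('m \<Rightarrow> 'n \<Rightarrow> 'p) \<Rightarrow> ('m \<times> 'n \<Rightarrow>\<^sub>0 int) set \<Rightarrow> 'p" where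
  "tensor_lift P f X = the_elem ((\<lambda>x. \<Oplus>\<^bsub>P\<^esub>p \<in> Poly_Mapping.keys x.
     [Poly_Mapping.lookup x p] \<cdot>\<^bsub>P\<^esub> f (fst p) (snd p)) ` X)"


section \<open>Universal differential forms\<close>

text \<open>\<open>B\<close> as a \<open>B\<close>-\<open>\<complex>\<close>-bimodule and as a \<open>\<complex>\<close>-\<open>B\<close>-bimodule, so that \<open>B \<otimes> B\<close> over \<open>\<complex>\<close> becomes
  a \<open>B\<close>-bimodule.\<close>

definition alg_right :: "(complex, 'b, 'x) module_scheme \<Rightarrow> ('b, 'b, complex) bimodule" where
  "alg_right B = \<lparr>carrier = carrier B, mult = undefined, one = undefined, zero = \<zero>\<^bsub>B\<^esub>, add = add B,
     smult = monoid.mult B, rsmult = (\<lambda>b c. c \<odot>\<^bsub>B\<^esub> b)\<rparr>"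

definition alg_left :: "(complex, 'b, 'x) module_scheme \<Rightarrow> (complex, 'b, 'b) bimodule" where
  "alg_left B = \<lparr>carrier = carrier B, mult = undefined, one = undefined, zero = \<zero>\<^bsub>B\<^esub>, add = add B,
     smult = smult B, rsmult = monoid.mult B\<rparr>"

definition alg_tensor :: "(complex, 'b, 'x) module_scheme
    \<Rightarrow> ('b, ('b \<times> 'b \<Rightarrow>\<^sub>0 int) set, 'b) bimodule" where
  "alg_tensor B = tensor complex_ring (alg_right B) (alg_left B)"

definition alg_pure :: "(complex, 'b, 'x) module_scheme \<Rightarrow> 'b \<Rightarrow> 'b \<Rightarrow> ('b \<times> 'b \<Rightarrow>\<^sub>0 int) set" where
  "alg_pure B = pure_tensor complex_ring (alg_right B) (alg_left B)"

text \<open>The kernel of the multiplication \<open>B \<otimes> B \<rightarrow> B\<close>, and on it the differentials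
  \<open>\<delta>(b) = 1 \<otimes> b - b \<otimes> 1\<close> (\<open>univ_d0\<close>) and \<open>\<delta>(b\<^sub>0 \<delta>(b\<^sub>1)) = \<delta>(b\<^sub>0) \<delta>(b\<^sub>1)\<close> (\<open>univ_d1\<close>).  Since
  \<open>b\<^sub>0 \<delta>(b\<^sub>1) = b\<^sub>0 \<otimes> b\<^sub>1 - b\<^sub>0 b\<^sub>1 \<otimes> 1\<close> and \<open>\<delta>(1) = 0\<close>, the latter is the restriction of
  \<open>b \<otimes> b' \<mapsto> \<delta>(b) \<otimes>\<^sub>B \<delta>(b')\<close>.\<close>

definition univ_forms1 :: "(complex, 'b, 'x) module_scheme
    \<Rightarrow> ('b, ('b \<times> 'b \<Rightarrow>\<^sub>0 int) set, 'b) bimodule" where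
  "univ_forms1 B = (alg_tensor B)
     \<lparr>carrier := {X \<in> carrier (alg_tensor B). tensor_lift B (monoid.mult B) X = \<zero>\<^bsub>B\<^esub>}\<rparr>"

definition univ_forms2 :: "(complex, 'b, 'x) module_scheme
    \<Rightarrow> ('b, (('b \<times> 'b \<Rightarrow>\<^sub>0 int) set \<times> ('b \<times> 'b \<Rightarrow>\<^sub>0 int) set \<Rightarrow>\<^sub>0 int) set, 'b) bimodule" where
  "univ_forms2 B = tensor B (univ_forms1 B) (univ_forms1 B)"

definition univ_d0 :: "(complex, 'b, 'x) module_scheme \<Rightarrow> 'b \<Rightarrow> ('b \<times> 'b \<Rightarrow>\<^sub>0 int) set" where
  "univ_d0 B b = alg_pure B \<one>\<^bsub>B\<^esub> b \<ominus>\<^bsub>alg_tensor B\<^esub> alg_pure B b \<one>\<^bsub>B\<^esub>"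

definition univ_d1 :: "(complex, 'b, 'x) module_scheme \<Rightarrow> ('b \<times> 'b \<Rightarrow>\<^sub>0 int) set
    \<Rightarrow> (('b \<times> 'b \<Rightarrow>\<^sub>0 int) set \<times> ('b \<times> 'b \<Rightarrow>\<^sub>0 int) set \<Rightarrow>\<^sub>0 int) set" where
  "univ_d1 B = tensor_lift (univ_forms2 B)
     (\<lambda>b b'. pure_tensor B (univ_forms1 B) (univ_forms1 B) (univ_d0 B b) (univ_d0 B b'))"


section \<open>First order calculi and weak second order structures\<close>

text \<open>The set of all \<open>b dc\<close> is closed under complex multiples, so its linear span is the
  additive subgroup it generates.\<close>

locale first_order_calculus = complex_bimodule B M
  for B :: "(complex, 'b, 'x) module_scheme" and M :: "('b, 'm, 'b, 'z) bimodule_scheme" +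
  fixes d :: "'b \<Rightarrow> 'm"
  assumes d_closed: "d \<in> carrier B \<rightarrow> carrier M"
    and d_add: "\<lbrakk>a \<in> carrier B; b \<in> carrier B\<rbrakk> \<Longrightarrow> d (a \<oplus>\<^bsub>B\<^esub> b) = d a \<oplus>\<^bsub>M\<^esub> d b"
    and d_scale: "b \<in> carrier B \<Longrightarrow> d (c \<odot>\<^bsub>B\<^esub> b) = cscale B M c (d b)"
    and d_Leibniz: "\<lbrakk>a \<in> carrier B; b \<in> carrier B\<rbrakk>
      \<Longrightarrow> d (a \<otimes>\<^bsub>B\<^esub> b) = d a \<odot>\<^sub>r\<^bsub>M\<^esub> b \<oplus>\<^bsub>M\<^esub> a \<odot>\<^bsub>M\<^esub> d b"
    and span: "carrier M =
      generate (add_monoid M) {b \<odot>\<^bsub>M\<^esub> d c | b c. b \<in> carrier B \<and> c \<in> carrier B}"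

text \<open>\<open>\<pi>(b\<^sub>0 \<delta>(b\<^sub>1)) = b\<^sub>0 db\<^sub>1\<close>, as the restriction of \<open>b \<otimes> b' \<mapsto> b db'\<close>.\<close>

definition univ_proj1 :: "('b, 'm, 'b, 'z) bimodule_scheme \<Rightarrow> ('b \<Rightarrow> 'm)
    \<Rightarrow> ('b \<times> 'b \<Rightarrow>\<^sub>0 int) set \<Rightarrow> 'm" where
  "univ_proj1 M d = tensor_lift M (\<lambda>b b'. b \<odot>\<^bsub>M\<^esub> d b')"

definition univ_proj2 :: "(complex, 'b, 'x) module_scheme \<Rightarrow> ('b, 'm, 'b, 'z) bimodule_scheme
    \<Rightarrow> ('b \<Rightarrow> 'm) \<Rightarrow> (('b \<times> 'b \<Rightarrow>\<^sub>0 int) set \<times> ('b \<times> 'b \<Rightarrow>\<^sub>0 int) set \<Rightarrow>\<^sub>0 int) set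
    \<Rightarrow> ('m \<times> 'm \<Rightarrow>\<^sub>0 int) set" where
  "univ_proj2 B M d = tensor_lift (tensor B M M)
     (\<lambda>x y. pure_tensor B M M (univ_proj1 M d x) (univ_proj1 M d y))"

definition JT2 :: "(complex, 'b, 'x) module_scheme \<Rightarrow> ('b, 'm, 'b, 'z) bimodule_scheme
    \<Rightarrow> ('b \<Rightarrow> 'm) \<Rightarrow> ('m \<times> 'm \<Rightarrow>\<^sub>0 int) set set" where
  "JT2 B M d = {univ_proj2 B M d (univ_d1 B x) | x.
     x \<in> carrier (univ_forms1 B) \<and> univ_proj1 M d x = \<zero>\<^bsub>M\<^esub>}"

locale weak_second_order_structure = first_order_calculus B M d
  for B :: "(complex, 'b, 'x) module_scheme" and M :: "('b, 'm, 'b, 'z) bimodule_scheme"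
    and d :: "'b \<Rightarrow> 'm" +
  fixes \<psi> :: "('m \<times> 'm \<Rightarrow>\<^sub>0 int) set \<Rightarrow> ('m \<times> 'm \<Rightarrow>\<^sub>0 int) set"
  assumes psi_hom: "\<psi> \<in> bimodule_hom B B (tensor B M M) (tensor B M M)"
    and psi_idem: "X \<in> carrier (tensor B M M) \<Longrightarrow> \<psi> (\<psi> X) = \<psi> X"
    and JT2_subset: "JT2 B M d \<subseteq> \<psi> ` carrier (tensor B M M)"

text \<open>The map \<open>1 - f\<close> on an additive group.\<close>

definition one_minus :: "('t, 'x) ring_scheme \<Rightarrow> ('t \<Rightarrow> 't) \<Rightarrow> 't \<Rightarrow> 't" where
  "one_minus T f = (\<lambda>t. t \<ominus>\<^bsub>T\<^esub> f t)"

text \<open>\<open>d\<^sub>\<psi>(\<omega>)\<close> is the common value of \<open>(1 - \<psi>)(\<pi>\<^sub>2(\<delta>(x)))\<close> for all lifts \<open>x\<close> of \<open>\<omega>\<close>, with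
  \<open>\<pi>\<^sub>2\<close> the map \<^const>\<open>univ_proj2\<close>.\<close>

definition d_psi :: "(complex, 'b, 'x) module_scheme \<Rightarrow> ('b, 'm, 'b, 'z) bimodule_scheme
    \<Rightarrow> ('b \<Rightarrow> 'm) \<Rightarrow> (('m \<times> 'm \<Rightarrow>\<^sub>0 int) set \<Rightarrow> ('m \<times> 'm \<Rightarrow>\<^sub>0 int) set)
    \<Rightarrow> 'm \<Rightarrow> ('m \<times> 'm \<Rightarrow>\<^sub>0 int) set" where
  "d_psi B M d \<psi> \<omega> = the_elem
     {one_minus (tensor B M M) \<psi> (univ_proj2 B M d (univ_d1 B x)) | x.
        x \<in> carrier (univ_forms1 B) \<and> univ_proj1 M d x = \<omega>}"

locale left_connection =
  fixes B :: "(complex, 'b, 'x) module_scheme" and M :: "('b, 'm, 'b, 'z) bimodule_scheme"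
    and d :: "'b \<Rightarrow> 'm" and nabla :: "'m \<Rightarrow> ('m \<times> 'm \<Rightarrow>\<^sub>0 int) set"
  assumes nabla_closed: "nabla \<in> carrier M \<rightarrow> carrier (tensor B M M)"
    and nabla_add: "\<lbrakk>\<omega> \<in> carrier M; \<eta> \<in> carrier M\<rbrakk>
      \<Longrightarrow> nabla (\<omega> \<oplus>\<^bsub>M\<^esub> \<eta>) = nabla \<omega> \<oplus>\<^bsub>tensor B M M\<^esub> nabla \<eta>"
    and nabla_scale: "\<omega> \<in> carrier M
      \<Longrightarrow> nabla (cscale B M c \<omega>) = cscale B (tensor B M M) c (nabla \<omega>)"
    and nabla_Leibniz: "\<lbrakk>b \<in> carrier B; \<omega> \<in> carrier M\<rbrakk>
      \<Longrightarrow> nabla (b \<odot>\<^bsub>M\<^esub> \<omega>) = b \<odot>\<^bsub>tensor B M M\<^esub> nabla \<omega> \<oplus>\<^bsub>tensor B M M\<^esub> pure_tensor B M M (d b) \<omega>"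


section \<open>Differential calculi\<close>

text \<open>The algebra \<open>W\<close> of all forms is the internal direct sum of the subspaces \<open>\<Omega> k\<close>.  The form
  product \<open>\<and>\<close> is the multiplication of \<open>W\<close>, and \<open>B\<close> literally is the degree 0 part.\<close>

locale differential_calculus =
  base: complex_algebra B + complex_algebra W
  for B :: "(complex, 'w) module" and W :: "(complex, 'w) module" (structure) +
  fixes \<Omega> :: "nat \<Rightarrow> 'w set" and d :: "'w \<Rightarrow> 'w"
  assumes degree_0: "B = W\<lparr>carrier := \<Omega> 0\<rparr>"
    and subspace: "submodule (\<Omega> k) complex_ring W"
    and direct_sum: "w \<in> carrier W \<Longrightarrow>
      \<exists>!f. (\<forall>k. f k \<in> \<Omega> k) \<and> finite {k. f k \<noteq> \<zero>} \<and> w = (\<Oplus>k \<in> {k. f k \<noteq> \<zero>}. f k)"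
    and graded: "\<lbrakk>x \<in> \<Omega> k; y \<in> \<Omega> l\<rbrakk> \<Longrightarrow> x \<otimes> y \<in> \<Omega> (k + l)"
    and d_degree: "x \<in> \<Omega> k \<Longrightarrow> d x \<in> \<Omega> (Suc k)"
    and d_add: "\<lbrakk>x \<in> carrier W; y \<in> carrier W\<rbrakk> \<Longrightarrow> d (x \<oplus> y) = d x \<oplus> d y"
    and d_scale: "x \<in> carrier W \<Longrightarrow> d (c \<odot> x) = c \<odot> d x"
    and d_d: "x \<in> carrier W \<Longrightarrow> d (d x) = \<zero>"
    and graded_Leibniz: "\<lbrakk>x \<in> \<Omega> k; y \<in> carrier W\<rbrakk>
      \<Longrightarrow> d (x \<otimes> y) = (if even k then d x \<otimes> y \<oplus> x \<otimes> d y else d x \<otimes> y \<ominus> x \<otimes> d y)"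
    and generated: "\<lbrakk>subring S W; submodule S complex_ring W; carrier B \<union> d ` carrier B \<subseteq> S\<rbrakk>
      \<Longrightarrow> S = carrier W"

definition form_bimodule :: "(complex, 'w, 'x) module_scheme \<Rightarrow> (nat \<Rightarrow> 'w set) \<Rightarrow> nat
    \<Rightarrow> ('w, 'w, 'w) bimodule" where
  "form_bimodule W \<Omega> k = \<lparr>carrier = \<Omega> k, mult = undefined, one = undefined,
     zero = \<zero>\<^bsub>W\<^esub>, add = add W, smult = monoid.mult W, rsmult = monoid.mult W\<rparr>"

definition wedge :: "(complex, 'w, 'x) module_scheme \<Rightarrow> (nat \<Rightarrow> 'w set) \<Rightarrow> ('w \<times> 'w \<Rightarrow>\<^sub>0 int) set \<Rightarrow> 'w" where
  "wedge W \<Omega> = tensor_lift (form_bimodule W \<Omega> 2) (monoid.mult W)"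

locale quasi_tame_calculus = differential_calculus B W \<Omega> d
  for B :: "(complex, 'w) module" and W :: "(complex, 'w) module" (structure)
    and \<Omega> :: "nat \<Rightarrow> 'w set" and d :: "'w \<Rightarrow> 'w" +
  fixes s :: "'w \<Rightarrow> ('w \<times> 'w \<Rightarrow>\<^sub>0 int) set"
  assumes Omega1_fgp: "fg_projective B (form_bimodule W \<Omega> 1)"
    and s_hom: "s \<in> bimodule_hom B B (form_bimodule W \<Omega> 2)
      (tensor B (form_bimodule W \<Omega> 1) (form_bimodule W \<Omega> 1))"
    and wedge_s: "x \<in> \<Omega> 2 \<Longrightarrow> wedge W \<Omega> (s x) = x"

definition psi_s :: "(complex, 'w) module \<Rightarrow> (complex, 'w) module \<Rightarrow> (nat \<Rightarrow> 'w set)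
    \<Rightarrow> ('w \<Rightarrow> ('w \<times> 'w \<Rightarrow>\<^sub>0 int) set) \<Rightarrow> ('w \<times> 'w \<Rightarrow>\<^sub>0 int) set \<Rightarrow> ('w \<times> 'w \<Rightarrow>\<^sub>0 int) set" where
  "psi_s B W \<Omega> s = one_minus (tensor B (form_bimodule W \<Omega> 1) (form_bimodule W \<Omega> 1)) (s \<circ> wedge W \<Omega>)"

end

theory Submission
  imports Defs
begin

text \<open>
  Since \<open>\<and> \<circ> s = id\<close>, the map \<open>1 - \<psi>\<^sub>s = s \<circ> \<and>\<close> turns \<open>\<nabla>\<close> into \<open>s \<circ> \<and> \<circ> \<nabla>\<close>.  On \<open>B \<otimes> B\<close> one has
  \<open>\<and> \<circ> \<pi>\<^sub>2 \<circ> \<delta> = d \<circ> \<pi>\<close>, both sides being additive with value \<open>db \<and> db'\<close> at \<open>b \<otimes> b'\<close>, so the map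
  associated with \<open>\<psi>\<^sub>s\<close> is \<open>s \<circ> d\<close>; it is defined on all of \<open>\<Omega>\<^sup>1\<close> because \<open>\<Omega>\<^sup>1\<close> is spanned by the
  forms \<open>b dc\<close>.  As \<open>s\<close> is injective, \<open>s \<circ> \<and> \<circ> \<nabla> = s \<circ> d\<close> is equivalent to \<open>\<and> \<circ> \<nabla> = d\<close>.
\<close>

section \<open>Abelian groups\<close>

text \<open>Universal one-forms are a kernel, and a kernel comes with no spanning set of pure
  tensors. For this reason \<pi> and \<delta> are handled on the whole tensor square of
  \<open>B\<close> over the complex numbers, where two additive maps that agree on pure tensors are
  equal. The price is that \<pi>, so extended, is no longer right linear; right linearity has to be
  recovered on the kernel before \<pi> \<otimes> \<pi> descends to the tensor square over
  \<open>B\<close>.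

  A second obstacle hides behind the word "spanned": a differential calculus is generated by
  \<open>B\<close> and \<open>dB\<close> only as an algebra, so a form of degree one is a priori
  just some element of that algebra. That it is a sum of forms \<open>b dc\<close> is a consequence
  of the uniqueness of homogeneous components.\<close>

lemma abelian_group_homI':
  assumes "abelian_group G" "abelian_group H"
    and "\<And>x. x \<in> carrier G \<Longrightarrow> h x \<in> carrier H"
    and "\<And>x y. \<lbrakk>x \<in> carrier G; y \<in> carrier G\<rbrakk> \<Longrightarrow> h (x \<oplus>\<^bsub>G\<^esub> y) = h x \<oplus>\<^bsub>H\<^esub> h y"
  shows "abelian_group_hom G H h"
  using assms
  by (intro abelian_group_homI group_hom.intro group_hom_axioms.intro)
    (auto simp: abelian_group.a_group hom_def)

text \<open>Integer multiples are group powers in the additive monoid. They are the coefficients in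
  the formal sums that \<open>tensor_lift\<close> evaluates.\<close>

lemma (in abelian_group) add_int_pow:
  fixes i j :: int
  assumes "x \<in> carrier G"
  shows "[i] \<cdot> x \<in> carrier G" "[(0::int)] \<cdot> x = \<zero>" "[(1::int)] \<cdot> x = x"
    "[(i + j)] \<cdot> x = [i] \<cdot> x \<oplus> [j] \<cdot> x"
  using group.int_pow_closed [OF a_group, of x i] group.int_pow_1 [OF a_group, of x]
    group.int_pow_mult [OF a_group, of x i j] assms
  by (simp_all add: add_pow_def)

lemma (in abelian_group) eq_if_minus_zero:
  assumes "x \<in> carrier G" "y \<in> carrier G" "x \<ominus> y = \<zero>"
  shows "x = y"
proof -
  have "x = (x \<ominus> y) \<oplus> y"
    using assms(1,2) by (simp add: minus_eq a_assoc l_neg)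
  then show ?thesis using assms by simp
qed

lemma (in abelian_group) eq_minusI:
  "\<lbrakk>z \<in> carrier G; y \<in> carrier G; z \<oplus> y = x\<rbrakk> \<Longrightarrow> z = x \<ominus> y"
  by (auto simp: minus_eq a_assoc r_neg)

lemma abelian_group_hom_compose:
  assumes "abelian_group_hom G H h" "abelian_group_hom H K k"
  shows "abelian_group_hom G K (\<lambda>x. k (h x))"
proof -
  interpret h: abelian_group_hom G H h by fact
  interpret k: abelian_group_hom H K k by fact
  show ?thesis
    by (rule abelian_group_homI') (auto intro: h.G.abelian_group_axioms k.H.abelian_group_axioms)
qed

lemma abelian_group_hom_cong:
  assumes "abelian_group_hom G H h" "\<And>x. x \<in> carrier G \<Longrightarrow> k x = h x"
  shows "abelian_group_hom G H k"
proof -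
  interpret abelian_group_hom G H h by fact
  show ?thesis
    by (rule abelian_group_homI') (auto simp: assms(2) G.abelian_group_axioms H.abelian_group_axioms)
qed

lemma abelian_group_carrier_add_zero:
  assumes "abelian_group G" "carrier H = carrier G" "add H = add G" "zero H = zero G"
  shows "abelian_group H"
  using abelian_groupE [OF assms(1)] by (intro abelian_groupI) (simp_all add: assms(2-4))

lemma (in abelian_group) minus_add_minus:
  "\<lbrakk>a \<in> carrier G; b \<in> carrier G; c \<in> carrier G; e \<in> carrier G\<rbrakk>
    \<Longrightarrow> (a \<oplus> b) \<ominus> (c \<oplus> e) = (a \<ominus> c) \<oplus> (b \<ominus> e)"
  by (simp add: minus_eq minus_add a_ac)

lemma abelian_group_hom_add:
  assumes "abelian_group_hom G H f" "abelian_group_hom G H g"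
  shows "abelian_group_hom G H (\<lambda>x. f x \<oplus>\<^bsub>H\<^esub> g x)"
proof -
  interpret f: abelian_group_hom G H f by fact
  interpret g: abelian_group_hom G H g by fact
  show ?thesis
    by (rule abelian_group_homI' [OF f.G.abelian_group_axioms f.H.abelian_group_axioms])
      (auto simp: f.H.a_ac)
qed

text \<open>Homogeneous decompositions can be added and negated degree by degree, so they exist on
  the whole generated subgroup. The conclusion, with the exact support as index set, has the shape
  of \<open>direct_sum\<close> in a differential calculus, so that uniqueness can be applied to
  it.\<close>

lemma (in abelian_group) generate_graded:
  fixes S :: "nat \<Rightarrow> 'a set"
  assumes S: "\<And>k. subgroup (S k) (add_monoid G)"
    and x: "x \<in> generate (add_monoid G) (\<Union>k. S k)"
  shows "\<exists>f. (\<forall>k. f k \<in> S k) \<and> finite {k. f k \<noteq> \<zero>} \<and> x = (\<Oplus>k \<in> {k. f k \<noteq> \<zero>}. f k)"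
proof -
  note sub = subgroup.subset [OF S, simplified, THEN subsetD]
    and zero = subgroup.one_closed [OF S, simplified]
    and add = subgroup.m_closed [OF S, simplified]
    and inv = subgroup.m_inv_closed [OF S, simplified, folded a_inv_def]
  have single: "\<exists>f A. (\<forall>k. f k \<in> S k) \<and> finite A \<and> (\<forall>k. k \<notin> A \<longrightarrow> f k = \<zero>) \<and> y = (\<Oplus>k \<in> A. f k)"
    if "y \<in> S i" for y i
    using that sub [OF that] zero
    by (intro exI [of _ "\<lambda>k. if k = i then y else \<zero>"] exI [of _ "{i}"]) (simp add: finsum_insert)
  \<comment> \<open>A finite superset \<open>A\<close> of the support is carried through the
    induction, since two summands have different supports and cancellation may shrink that of their
    sum. The exact support is restored afterwards.\<close>
  have "\<exists>f A. (\<forall>k. f k \<in> S k) \<and> finite A \<and> (\<forall>k. k \<notin> A \<longrightarrow> f k = \<zero>) \<and> x = (\<Oplus>k \<in> A. f k)"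
    using x
  proof (induction rule: generate.induct)
    case one
    show ?case using single [OF zero] by simp
  next
    case (incl y)
    then show ?case using single by blast
  next
    case (inv y)
    then obtain i where "y \<in> S i" by blast
    then show ?case by (rule single [OF subgroup.m_inv_closed [OF S]])
  next
    case (eng y z)
    then obtain f A g C where
      f: "\<And>k. f k \<in> S k" "finite A" "\<And>k. k \<notin> A \<Longrightarrow> f k = \<zero>" "y = (\<Oplus>k \<in> A. f k)" and
      g: "\<And>k. g k \<in> S k" "finite C" "\<And>k. k \<notin> C \<Longrightarrow> g k = \<zero>" "z = (\<Oplus>k \<in> C. g k)"
      by metis
    note closed = sub [OF f(1)] sub [OF g(1)]
    have "y = (\<Oplus>k \<in> A \<union> C. f k)"
      unfolding f(4) using f(2,3) g(2) closed by (intro add.finprod_mono_neutral_cong_left) auto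
    moreover have "z = (\<Oplus>k \<in> A \<union> C. g k)"
      unfolding g(4) using f(2) g(2,3) closed by (intro add.finprod_mono_neutral_cong_left) auto
    ultimately have "y \<oplus> z = (\<Oplus>k \<in> A \<union> C. f k \<oplus> g k)"
      using closed by (simp add: finsum_addf)
    then show ?case
      using f g add by (intro exI [of _ "\<lambda>k. f k \<oplus> g k"] exI [of _ "A \<union> C"]) simp
  qed
  then obtain f A where f: "\<And>k. f k \<in> S k" "finite A" "\<And>k. k \<notin> A \<Longrightarrow> f k = \<zero>" "x = (\<Oplus>k \<in> A. f k)"
    by metis
  have "{k. f k \<noteq> \<zero>} \<subseteq> A"
    using f(3) by blast
  moreover have "x = (\<Oplus>k \<in> {k. f k \<noteq> \<zero>}. f k)"
    unfolding f(4) using f(2) \<open>{k. f k \<noteq> \<zero>} \<subseteq> A\<close> sub [OF f(1)]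
    by (intro add.finprod_mono_neutral_cong_right) auto
  ultimately show ?thesis
    using f(1) finite_subset [OF _ f(2)] by blast
qed

text \<open>Meant for multiplication by a fixed element: closure of a span under such a
  multiplication is reduced to the generators.\<close>

lemma (in abelian_group_hom) hom_generate:
  assumes "K \<subseteq> carrier G" "L \<subseteq> carrier H"
    and K: "\<And>x. x \<in> K \<Longrightarrow> h x \<in> generate (add_monoid H) L"
    and x: "x \<in> generate (add_monoid G) K"
  shows "h x \<in> generate (add_monoid H) L"
  using x
proof (induction rule: generate.induct)
  case one
  show ?case using generate.one [of "add_monoid H" L] by simp
next
  case (incl x)
  then show ?case by (rule K)
next
  case (inv x)
  then show ?case
    using assms(1) group.generate_m_inv_closed [OF H.a_group _ K [OF inv]] assms(2)
    by (auto simp flip: a_inv_def)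
next
  case (eng x y)
  moreover have "x \<in> carrier G" "y \<in> carrier G"
    using eng(1,2) group.generate_in_carrier [OF G.a_group, of K] assms(1) by auto
  ultimately show ?case
    using generate.eng [of "h x" "add_monoid H" L "h y"] by simp
qed

lemma (in abelian_group) minus_minus_cancel:
  "\<lbrakk>x \<in> carrier G; y \<in> carrier G\<rbrakk> \<Longrightarrow> x \<ominus> (x \<ominus> y) = y"
  by (simp add: minus_eq minus_add r_neg2)

section \<open>Tensor products\<close>

definition balanced_map :: "('r, 'z) ring_scheme \<Rightarrow> ('a, 'm, 'r, 'x) bimodule_scheme
    \<Rightarrow> ('r, 'n, 'c, 'y) bimodule_scheme \<Rightarrow> ('p, 'w) ring_scheme \<Rightarrow> ('m \<Rightarrow> 'n \<Rightarrow> 'p) \<Rightarrow> bool" where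
  "balanced_map R M N P f \<longleftrightarrow>
     (\<forall>m \<in> carrier M. \<forall>n \<in> carrier N. f m n \<in> carrier P) \<and>
     (\<forall>m \<in> carrier M. \<forall>m' \<in> carrier M. \<forall>n \<in> carrier N. f (m \<oplus>\<^bsub>M\<^esub> m') n = f m n \<oplus>\<^bsub>P\<^esub> f m' n) \<and>
     (\<forall>m \<in> carrier M. \<forall>n \<in> carrier N. \<forall>n' \<in> carrier N. f m (n \<oplus>\<^bsub>N\<^esub> n') = f m n \<oplus>\<^bsub>P\<^esub> f m n') \<and>
     (\<forall>m \<in> carrier M. \<forall>r \<in> carrier R. \<forall>n \<in> carrier N. f (m \<odot>\<^sub>r\<^bsub>M\<^esub> r) n = f m (r \<odot>\<^bsub>N\<^esub> n))"

text \<open>The quotient and its universal property are pure group theory, so closure under the two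
  inner actions is all that is asked. One development thus serves three tensor products: of
  \<open>B\<close> with itself over the complex numbers, of the universal one-forms, and of a first
  order calculus with itself.\<close>

locale tensor_pair = M: abelian_group M + N: abelian_group N
  for R :: "('r, 'z) ring_scheme" and M :: "('a, 'm, 'r, 'x) bimodule_scheme"
    and N :: "('r, 'n, 'c, 'y) bimodule_scheme" +
  assumes rsmult_closed: "\<lbrakk>m \<in> carrier M; r \<in> carrier R\<rbrakk> \<Longrightarrow> m \<odot>\<^sub>r\<^bsub>M\<^esub> r \<in> carrier M"
    and lsmult_closed: "\<lbrakk>r \<in> carrier R; n \<in> carrier N\<rbrakk> \<Longrightarrow> r \<odot>\<^bsub>N\<^esub> n \<in> carrier N"
begin

abbreviation "F \<equiv> tensor_free M N"
abbreviation "Null \<equiv> tensor_null R M N"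
abbreviation "T \<equiv> tensor R M N"
abbreviation "pure \<equiv> pure_tensor R M N"
abbreviation "coset x \<equiv> Null #>\<^bsub>F\<^esub> x"

lemma comm_group_free: "comm_group F"
  by (simp add: tensor_free_def abelian_free_Abelian_group)

lemma tensor_free_mem: "x \<in> carrier F \<longleftrightarrow> Poly_Mapping.keys x \<subseteq> carrier M \<times> carrier N"
  by (simp add: tensor_free_def)

lemma add_in_free: "x \<in> carrier F \<Longrightarrow> y \<in> carrier F \<Longrightarrow> x + y \<in> carrier F"
  using keys_add by (fastforce simp: tensor_free_def)

lemma minus_in_free: "x \<in> carrier F \<Longrightarrow> y \<in> carrier F \<Longrightarrow> x - y \<in> carrier F"
  using keys_diff by (fastforce simp: tensor_free_def)

lemma relations_closed: "tensor_relations R M N \<subseteq> carrier F"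
  unfolding tensor_relations_def
  by (auto simp: rsmult_closed lsmult_closed tensor_free_def dest!: subsetD [OF keys_diff])

lemma null_subgroup: "subgroup Null F"
  unfolding tensor_null_def
  by (rule group.generate_is_subgroup [OF comm_group.axioms(2) [OF comm_group_free] relations_closed])

lemma null_normal: "Null \<lhd> F"
  by (simp add: comm_group.normal_iff_subgroup [OF comm_group_free] null_subgroup)

lemma tensor_simps:
  "carrier T = coset ` carrier F"
  "add T = set_mult F" "zero T = Null"
  by (auto simp: tensor_def carrier_FactGroup)

lemma coset_add: "\<lbrakk>x \<in> carrier F; y \<in> carrier F\<rbrakk> \<Longrightarrow> coset x \<oplus>\<^bsub>T\<^esub> coset y = coset (x + y)"
  using normal.rcos_sum [OF null_normal] by (simp add: tensor_simps tensor_free_def)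

lemma abelian_group_tensor: "abelian_group T"
proof -
  have "comm_group (F Mod Null)"
    by (rule comm_group.abelian_FactGroup [OF comm_group_free null_subgroup])
  note * = comm_groupE[OF this]
  show ?thesis
    by (rule abelian_groupI) (use * in \<open>simp_all add: tensor_def\<close>)
qed

sublocale T: abelian_group T
  by (rule abelian_group_tensor)

lemma coset_zero: "coset 0 = \<zero>\<^bsub>T\<^esub>"
  using group.coset_mult_one [OF comm_group.axioms(2) [OF comm_group_free] subgroup.subset [OF null_subgroup]]
  by (simp add: tensor_simps tensor_free_def)

lemma coset_closed: "x \<in> carrier F \<Longrightarrow> coset x \<in> carrier T"
  by (auto simp: tensor_simps)

lemma coset_diff:
  assumes "x \<in> carrier F" "y \<in> carrier F"
  shows "coset (x - y) = coset x \<ominus>\<^bsub>T\<^esub> coset y"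
proof -
  have "coset (x - y) \<oplus>\<^bsub>T\<^esub> coset y = coset x"
    using assms minus_in_free by (subst coset_add) auto
  then show ?thesis
    using assms by - (rule T.eq_minusI; auto intro: coset_closed minus_in_free)
qed

lemma coset_eq_zero: "x \<in> Null \<Longrightarrow> coset x = \<zero>\<^bsub>T\<^esub>"
  using subgroup.rcos_const [OF null_subgroup comm_group.axioms(2) [OF comm_group_free]]
  by (simp add: tensor_simps)

lemma pure_closed: "\<lbrakk>m \<in> carrier M; n \<in> carrier N\<rbrakk> \<Longrightarrow> pure m n \<in> carrier T"
  unfolding pure_tensor_def by (rule coset_closed) (simp add: tensor_free_def)

text \<open>Each relation is regrouped as a difference of the two elements that become equal in the
  quotient.\<close>

lemma relations_null:
  "\<lbrakk>m \<in> carrier M; m' \<in> carrier M; n \<in> carrier N\<rbrakk>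
    \<Longrightarrow> frag_of (m \<oplus>\<^bsub>M\<^esub> m', n) - (frag_of (m, n) + frag_of (m', n)) \<in> Null"
  "\<lbrakk>m \<in> carrier M; n \<in> carrier N; n' \<in> carrier N\<rbrakk>
    \<Longrightarrow> frag_of (m, n \<oplus>\<^bsub>N\<^esub> n') - (frag_of (m, n) + frag_of (m, n')) \<in> Null"
  "\<lbrakk>m \<in> carrier M; r \<in> carrier R; n \<in> carrier N\<rbrakk>
    \<Longrightarrow> frag_of (m \<odot>\<^sub>r\<^bsub>M\<^esub> r, n) - frag_of (m, r \<odot>\<^bsub>N\<^esub> n) \<in> Null"
  unfolding tensor_null_def tensor_relations_def diff_diff_eq [symmetric]
    apply (rule generate.incl, rule UnI1, rule UnI1, rule CollectI, intro exI conjI, rule refl; assumption)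
   apply (rule generate.incl, rule UnI1, rule UnI2, rule CollectI, intro exI conjI, rule refl; assumption)
  apply (rule generate.incl, rule UnI2, rule CollectI, intro exI conjI, rule refl; assumption)
  done

lemma frag_of_in_free: "\<lbrakk>m \<in> carrier M; n \<in> carrier N\<rbrakk> \<Longrightarrow> frag_of (m, n) \<in> carrier F"
  by (simp add: tensor_free_def)

lemma balanced_pure: "balanced_map R M N T pure"
proof -
  have eq: "coset x = coset y" if "x - y \<in> Null" "x \<in> carrier F" "y \<in> carrier F" for x y
    by (rule T.eq_if_minus_zero)
      (simp_all only: that(2,3) coset_closed coset_eq_zero [OF that(1)] flip: coset_diff)
  note closed = frag_of_in_free add_in_free M.a_closed N.a_closed rsmult_closed lsmult_closed
  have "pure (m \<oplus>\<^bsub>M\<^esub> m') n = pure m n \<oplus>\<^bsub>T\<^esub> pure m' n"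
    if "m \<in> carrier M" "m' \<in> carrier M" "n \<in> carrier N" for m m' n
    unfolding pure_tensor_def using that by (subst coset_add) (intro eq relations_null closed; assumption)+
  moreover have "pure m (n \<oplus>\<^bsub>N\<^esub> n') = pure m n \<oplus>\<^bsub>T\<^esub> pure m n'"
    if "m \<in> carrier M" "n \<in> carrier N" "n' \<in> carrier N" for m n n'
    unfolding pure_tensor_def using that by (subst coset_add) (intro eq relations_null closed; assumption)+
  moreover have "pure (m \<odot>\<^sub>r\<^bsub>M\<^esub> r) n = pure m (r \<odot>\<^bsub>N\<^esub> n)"
    if "m \<in> carrier M" "r \<in> carrier R" "n \<in> carrier N" for m r n
    unfolding pure_tensor_def using that by (intro eq relations_null closed)
  ultimately show ?thesis
    using pure_closed by (auto simp: balanced_map_def)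
qed

lemma pure_simps:
  "\<lbrakk>m \<in> carrier M; m' \<in> carrier M; n \<in> carrier N\<rbrakk> \<Longrightarrow> pure (m \<oplus>\<^bsub>M\<^esub> m') n = pure m n \<oplus>\<^bsub>T\<^esub> pure m' n"
  "\<lbrakk>m \<in> carrier M; n \<in> carrier N; n' \<in> carrier N\<rbrakk> \<Longrightarrow> pure m (n \<oplus>\<^bsub>N\<^esub> n') = pure m n \<oplus>\<^bsub>T\<^esub> pure m n'"
  "\<lbrakk>m \<in> carrier M; r \<in> carrier R; n \<in> carrier N\<rbrakk> \<Longrightarrow> pure (m \<odot>\<^sub>r\<^bsub>M\<^esub> r) n = pure m (r \<odot>\<^bsub>N\<^esub> n)"
  using balanced_pure by (auto simp: balanced_map_def)

text \<open>Inherited from the free abelian group, whose elements arise from zero and the generators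
  by differences. Closure under differences covers sums and negatives at once.\<close>

lemma tensor_induct [consumes 1, case_names zero pure diff]:
  assumes X: "X \<in> carrier T"
    and zero: "Q \<zero>\<^bsub>T\<^esub>"
    and pure: "\<And>m n. \<lbrakk>m \<in> carrier M; n \<in> carrier N\<rbrakk> \<Longrightarrow> Q (pure m n)"
    and diff: "\<And>X Y. \<lbrakk>X \<in> carrier T; Y \<in> carrier T; Q X; Q Y\<rbrakk> \<Longrightarrow> Q (X \<ominus>\<^bsub>T\<^esub> Y)"
  shows "Q X"
proof -
  obtain x where x: "Poly_Mapping.keys x \<subseteq> carrier M \<times> carrier N" "X = coset x"
    using X by (auto simp: tensor_simps tensor_free_def)
  from x(1) have "Q (coset x)"
  proof (induction x rule: free_Abelian_group_induct [consumes 1, case_names zero diff pure])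
    case zero then show ?case by (simp add: coset_zero assms(2))
  next
    case (diff x y)
    then show ?case
      using coset_closed by (simp add: coset_diff tensor_free_mem assms(4))
  next
    case (pure a) then show ?case
      using assms(3) by (auto simp: pure_tensor_def)
  qed
  with x(2) show ?thesis by simp
qed

text \<open>Pure tensors generate the tensor product as a group. This is the standard way in which
  identities between maps on tensor products are proved below.\<close>

lemma tensor_hom_eqI:
  assumes "abelian_group_hom T P f" "abelian_group_hom T P g"
    and "\<And>m n. \<lbrakk>m \<in> carrier M; n \<in> carrier N\<rbrakk> \<Longrightarrow> f (pure m n) = g (pure m n)"
    and "X \<in> carrier T"
  shows "f X = g X"
proof -
  interpret f: abelian_group_hom T P f by fact
  interpret g: abelian_group_hom T P g by fact
  from assms(4) show ?thesis
    by (induction X rule: tensor_induct)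
      (auto simp: assms(3) T.minus_eq)
qed

section \<open>The universal property of the tensor product\<close>

context
  fixes P :: "('p, 'w) ring_scheme" and f :: "'m \<Rightarrow> 'n \<Rightarrow> 'p"
  assumes P: "abelian_group P" and f: "balanced_map R M N P f"
begin

interpretation P: abelian_group P by (rule P)

text \<open>The extension of \<open>f\<close> to formal sums before passing to cosets, spelled
  exactly as inside \<open>tensor_lift\<close> so that the latter is the common value of
  \<open>ext\<close> on a coset.\<close>

private definition ext :: "('m \<times> 'n \<Rightarrow>\<^sub>0 int) \<Rightarrow> 'p" where
  "ext x = (\<Oplus>\<^bsub>P\<^esub>p \<in> Poly_Mapping.keys x.
     [Poly_Mapping.lookup x p] \<cdot>\<^bsub>P\<^esub> f (fst p) (snd p))"

private lemma f_closed: "\<lbrakk>m \<in> carrier M; n \<in> carrier N\<rbrakk> \<Longrightarrow> f m n \<in> carrier P"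
  using f by (auto simp: balanced_map_def)

text \<open>Outside the support the coefficient is 0 and contributes nothing. A common index set is
  what makes the sums for \<open>x\<close>, \<open>y\<close> and \<open>x + y\<close>
  comparable.\<close>

private lemma ext_superset:
  assumes "finite A" "Poly_Mapping.keys x \<subseteq> A" "A \<subseteq> carrier M \<times> carrier N"
  shows "ext x = (\<Oplus>\<^bsub>P\<^esub>p \<in> A. [Poly_Mapping.lookup x p] \<cdot>\<^bsub>P\<^esub> f (fst p) (snd p))"
proof -
  have fp: "f (fst p) (snd p) \<in> carrier P" if "p \<in> A" for p
    using that assms(3) f_closed by auto
  show ?thesis
    unfolding ext_def
  proof (rule P.add.finprod_mono_neutral_cong_left [OF assms(1,2)])
    fix p assume "p \<in> A - Poly_Mapping.keys x"
    then show "[Poly_Mapping.lookup x p] \<cdot>\<^bsub>P\<^esub> f (fst p) (snd p) = \<zero>\<^bsub>P\<^esub>"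
      using fp by (simp add: in_keys_iff P.add_int_pow)
  qed (use fp P.add_int_pow(1) in auto)
qed

private lemma ext_frag_of: "\<lbrakk>m \<in> carrier M; n \<in> carrier N\<rbrakk> \<Longrightarrow> ext (frag_of (m, n)) = f m n"
  by (simp add: ext_def f_closed P.add_int_pow)

private lemma ext_closed: "x \<in> carrier F \<Longrightarrow> ext x \<in> carrier P"
  unfolding ext_def by (intro P.finsum_closed) (auto simp: tensor_free_def f_closed P.add_int_pow)

private lemma ext_add:
  assumes "x \<in> carrier F" "y \<in> carrier F"
  shows "ext (x + y) = ext x \<oplus>\<^bsub>P\<^esub> ext y"
proof -
  let ?A = "Poly_Mapping.keys x \<union> Poly_Mapping.keys y"
  have A: "finite ?A" "?A \<subseteq> carrier M \<times> carrier N"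
    using assms by (auto simp: tensor_free_def)
  have "f (fst p) (snd p) \<in> carrier P" if "p \<in> ?A" for p
    using that A(2) f_closed by auto
  note fp = this
  have "ext (x + y) = (\<Oplus>\<^bsub>P\<^esub>p \<in> ?A. [Poly_Mapping.lookup x p] \<cdot>\<^bsub>P\<^esub> f (fst p) (snd p) \<oplus>\<^bsub>P\<^esub>
      [Poly_Mapping.lookup y p] \<cdot>\<^bsub>P\<^esub> f (fst p) (snd p))"
    unfolding ext_superset [OF A(1) keys_add A(2)]
    by (intro P.finsum_cong') (auto simp: lookup_add P.add_int_pow fp)
  also have "\<dots> = ext x \<oplus>\<^bsub>P\<^esub> ext y"
    unfolding ext_superset [OF A(1) Un_upper1 A(2)] ext_superset [OF A(1) Un_upper2 A(2)]
    using fp by (intro P.finsum_addf) (auto simp: P.add_int_pow)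
  finally show ?thesis .
qed

private lemma ext_hom: "group_hom F (add_monoid P) ext"
  using comm_group.axioms(2) [OF comm_group_free] P.a_group
  by (intro group_hom.intro group_hom_axioms.intro)
    (auto simp: hom_def ext_closed ext_add tensor_free_def)

private lemma ext_diff:
  assumes "x \<in> carrier F" "y \<in> carrier F"
  shows "ext (x - y) = ext x \<ominus>\<^bsub>P\<^esub> ext y"
proof -
  have "ext (x - y) \<oplus>\<^bsub>P\<^esub> ext y = ext x"
    using assms minus_in_free by (subst ext_add [symmetric]) auto
  then show ?thesis
    using assms by - (rule P.eq_minusI; auto intro: ext_closed minus_in_free)
qed

text \<open>The relations lie in the kernel of \<open>ext\<close>, and a kernel is a subgroup, so it
  contains all that they generate.\<close>

private lemma ext_null: "x \<in> Null \<Longrightarrow> ext x = \<zero>\<^bsub>P\<^esub>"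
proof -
  \<comment> \<open>Both biadditivity relations are sent to this expression, with \<open>a\<close>
    and \<open>b\<close> the values of \<open>f\<close> on the two summands.\<close>
  have cancel: "a \<oplus>\<^bsub>P\<^esub> b \<ominus>\<^bsub>P\<^esub> a \<ominus>\<^bsub>P\<^esub> b = \<zero>\<^bsub>P\<^esub>" if "a \<in> carrier P" "b \<in> carrier P" for a b
  proof -
    have "a \<oplus>\<^bsub>P\<^esub> b \<ominus>\<^bsub>P\<^esub> a = b"
      using that by (simp add: P.minus_eq P.a_assoc P.a_comm [of b "\<ominus>\<^bsub>P\<^esub> a"] P.r_neg2)
    then show ?thesis using that by (simp add: P.minus_eq P.r_neg)
  qed
  have "ext x = \<zero>\<^bsub>P\<^esub>" if "x \<in> tensor_relations R M N" for x
    using that unfolding tensor_relations_def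
  proof (elim UnE CollectE exE conjE)
    fix m m' n
    assume "x = frag_of (m \<oplus>\<^bsub>M\<^esub> m', n) - frag_of (m, n) - frag_of (m', n)"
      "m \<in> carrier M" "m' \<in> carrier M" "n \<in> carrier N"
    then show ?thesis
      using f f_closed cancel
      by (auto simp: ext_diff ext_frag_of minus_in_free frag_of_in_free balanced_map_def)
  next
    fix m n n'
    assume "x = frag_of (m, n \<oplus>\<^bsub>N\<^esub> n') - frag_of (m, n) - frag_of (m, n')"
      "m \<in> carrier M" "n \<in> carrier N" "n' \<in> carrier N"
    then show ?thesis
      using f f_closed cancel
      by (auto simp: ext_diff ext_frag_of minus_in_free frag_of_in_free balanced_map_def)
  next
    fix m r n
    assume "x = frag_of (m \<odot>\<^sub>r\<^bsub>M\<^esub> r, n) - frag_of (m, r \<odot>\<^bsub>N\<^esub> n)"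
      "m \<in> carrier M" "r \<in> carrier R" "n \<in> carrier N"
    then show ?thesis
      using f f_closed
      by (auto simp: ext_diff ext_frag_of frag_of_in_free rsmult_closed lsmult_closed
          balanced_map_def P.minus_eq P.r_neg)
  qed
  then have "tensor_relations R M N \<subseteq> kernel F (add_monoid P) ext"
    using relations_closed by (auto simp: kernel_def)
  then have "Null \<subseteq> kernel F (add_monoid P) ext"
    unfolding tensor_null_def
    by (rule group.generate_subgroup_incl [OF comm_group.axioms(2) [OF comm_group_free]])
      (rule group_hom.subgroup_kernel [OF ext_hom])
  then show "x \<in> Null \<Longrightarrow> ext x = \<zero>\<^bsub>P\<^esub>"
    by (auto simp: kernel_def)
qed

text \<open>Two representatives differ by an element of \<open>Null\<close>, where
  \<open>ext\<close> vanishes. This is the well-definedness on which \<open>the_elem\<close> in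
  \<open>tensor_lift\<close> depends.\<close>

private lemma image_ext_coset:
  assumes x: "x \<in> carrier F"
  shows "ext ` coset x = {ext x}"
proof -
  have "ext y = ext x" if y: "y \<in> coset x" for y
  proof -
    obtain z where "z \<in> Null" "y = z + x"
      using y by (auto simp: r_coset_def tensor_free_def)
    moreover have "z \<in> carrier F"
      using \<open>z \<in> Null\<close> subgroup.subset [OF null_subgroup] by auto
    ultimately show ?thesis
      using x ext_closed by (simp add: ext_add ext_null)
  qed
  moreover have "x \<in> coset x"
    by (rule group.rcos_self [OF comm_group.axioms(2) [OF comm_group_free] x null_subgroup])
  ultimately show ?thesis by blast
qed

private lemma tensor_lift_coset: "x \<in> carrier F \<Longrightarrow> tensor_lift P f (coset x) = ext x"
  unfolding tensor_lift_def ext_def [symmetric] by (simp only: image_ext_coset the_elem_eq)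

lemma tensor_lift_pure:
  "\<lbrakk>m \<in> carrier M; n \<in> carrier N\<rbrakk> \<Longrightarrow> tensor_lift P f (pure m n) = f m n"
  by (simp add: pure_tensor_def tensor_lift_coset frag_of_in_free ext_frag_of)

lemma tensor_lift_hom: "abelian_group_hom T P (tensor_lift P f)"
proof (rule abelian_group_homI' [OF abelian_group_tensor P])
  fix X Y assume "X \<in> carrier T" "Y \<in> carrier T"
  then obtain x y where x: "x \<in> carrier F" "X = coset x" and y: "y \<in> carrier F" "Y = coset y"
    by (auto simp: tensor_simps)
  then show "tensor_lift P f (X \<oplus>\<^bsub>T\<^esub> Y) = tensor_lift P f X \<oplus>\<^bsub>P\<^esub> tensor_lift P f Y"
    by (simp add: coset_add add_in_free tensor_lift_coset ext_add)
next
  fix X assume "X \<in> carrier T"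
  then show "tensor_lift P f X \<in> carrier P"
    by (auto simp: tensor_simps tensor_lift_coset ext_closed)
qed

text \<open>A map on formal sums that respects zero and differences is determined by its values on
  generators, so \<open>h\<close> coincides with \<open>ext\<close>. Maps given by a formula on
  representatives are recognised as lifts in this way.\<close>

lemma image_eq_tensor_lift:
  assumes "X \<in> carrier T" and "h 0 = \<zero>\<^bsub>P\<^esub>"
    and diff: "\<And>x y. \<lbrakk>x \<in> carrier F; y \<in> carrier F\<rbrakk> \<Longrightarrow> h (x - y) = h x \<ominus>\<^bsub>P\<^esub> h y"
    and pure: "\<And>m n. \<lbrakk>m \<in> carrier M; n \<in> carrier N\<rbrakk> \<Longrightarrow> h (frag_of (m, n)) = f m n"
  shows "h ` X = {tensor_lift P f X}"
proof -
  have h: "h x = ext x" if "Poly_Mapping.keys x \<subseteq> carrier M \<times> carrier N" for x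
    using that
  proof (induction x rule: free_Abelian_group_induct [consumes 1, case_names zero diff pure])
    case zero
    then show ?case by (simp add: ext_def assms(2))
  next
    case (diff x y)
    then show ?case by (simp add: assms(3) ext_diff tensor_free_mem)
  next
    case (pure p)
    then show ?case by (cases p) (auto simp: assms(4) ext_frag_of)
  qed
  obtain x where x: "x \<in> carrier F" "X = coset x"
    using assms(1) by (auto simp: tensor_simps)
  have "coset x \<subseteq> carrier F"
    by (rule monoid.r_coset_subset_G [OF comm_monoid.axioms(1) [OF comm_group.axioms(1) [OF comm_group_free]]
          subgroup.subset [OF null_subgroup] x(1)])
  then have "h ` coset x = ext ` coset x"
    by (intro image_cong) (auto simp: h tensor_free_mem)
  then show ?thesis
    using x by (simp add: image_ext_coset tensor_lift_coset)
qed

end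

text \<open>The actions on \<open>tensor\<close> are unions of cosets over all representatives; here
  such a union is identified with a lift. The left action is the case where \<beta> is the identity,
  the right action the case where \<alpha> is.\<close>

lemma tensor_lift_frag_extend:
  assumes g: "\<And>m n. \<lbrakk>m \<in> carrier M; n \<in> carrier N\<rbrakk> \<Longrightarrow> \<alpha> m \<in> carrier M \<and> \<beta> n \<in> carrier N"
    and bal: "balanced_map R M N T (\<lambda>m n. pure (\<alpha> m) (\<beta> n))" and X: "X \<in> carrier T"
  shows "(\<Union>x\<in>X. coset (frag_extend (\<lambda>(m, n). frag_of (\<alpha> m, \<beta> n)) x))
    = tensor_lift T (\<lambda>m n. pure (\<alpha> m) (\<beta> n)) X"
proof -
  let ?E = "frag_extend (\<lambda>(m, n). frag_of (\<alpha> m, \<beta> n))"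
  have "?E x \<in> carrier F" if "x \<in> carrier F" for x
  proof -
    have "Poly_Mapping.keys (case p of (m, n) \<Rightarrow> frag_of (\<alpha> m, \<beta> n)) \<subseteq> carrier M \<times> carrier N"
      if "p \<in> Poly_Mapping.keys x" for p
      using that g \<open>x \<in> carrier F\<close> by (cases p) (auto simp: tensor_free_mem)
    then show ?thesis
      unfolding tensor_free_mem by (intro order_trans [OF keys_frag_extend] UN_least)
  qed
  then have "(\<lambda>x. coset (?E x)) ` X = {tensor_lift T (\<lambda>m n. pure (\<alpha> m) (\<beta> n)) X}"
    by (intro image_eq_tensor_lift [OF abelian_group_tensor bal X])
      (simp_all add: coset_zero frag_extend_diff coset_diff pure_tensor_def)
  \<comment> \<open>All representatives yield the same coset, so the union runs over a single
    set.\<close>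
  then show ?thesis by (simp only: cSup_singleton)
qed

lemma smult_eq_lift:
  assumes "\<And>m. m \<in> carrier M \<Longrightarrow> a \<odot>\<^bsub>M\<^esub> m \<in> carrier M"
    and "balanced_map R M N T (\<lambda>m n. pure (a \<odot>\<^bsub>M\<^esub> m) n)" and "X \<in> carrier T"
  shows "a \<odot>\<^bsub>T\<^esub> X = tensor_lift T (\<lambda>m n. pure (a \<odot>\<^bsub>M\<^esub> m) n) X"
proof -
  have "a \<odot>\<^bsub>T\<^esub> X = (\<Union>x\<in>X. coset (frag_extend (\<lambda>(m, n). frag_of (a \<odot>\<^bsub>M\<^esub> m, n)) x))"
    unfolding tensor_def by (simp only: module.select_convs)
  also have "\<dots> = tensor_lift T (\<lambda>m n. pure (a \<odot>\<^bsub>M\<^esub> m) n) X"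
    using assms by (intro tensor_lift_frag_extend) simp
  finally show ?thesis .
qed

lemma rsmult_eq_lift:
  assumes "\<And>n. n \<in> carrier N \<Longrightarrow> n \<odot>\<^sub>r\<^bsub>N\<^esub> c \<in> carrier N"
    and "balanced_map R M N T (\<lambda>m n. pure m (n \<odot>\<^sub>r\<^bsub>N\<^esub> c))" and "X \<in> carrier T"
  shows "X \<odot>\<^sub>r\<^bsub>T\<^esub> c = tensor_lift T (\<lambda>m n. pure m (n \<odot>\<^sub>r\<^bsub>N\<^esub> c)) X"
proof -
  have "X \<odot>\<^sub>r\<^bsub>T\<^esub> c = (\<Union>x\<in>X. coset (frag_extend (\<lambda>(m, n). frag_of (m, n \<odot>\<^sub>r\<^bsub>N\<^esub> c)) x))"
    unfolding tensor_def by (simp only: bimodule.select_convs)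
  also have "\<dots> = tensor_lift T (\<lambda>m n. pure m (n \<odot>\<^sub>r\<^bsub>N\<^esub> c)) X"
    using assms by (intro tensor_lift_frag_extend) simp
  finally show ?thesis .
qed

end

section \<open>Universal forms\<close>

lemma alg_right_simps [simp]:
  "carrier (alg_right B) = carrier B" "add (alg_right B) = add B" "zero (alg_right B) = zero B"
  "smult (alg_right B) = monoid.mult B" "rsmult (alg_right B) = (\<lambda>b c. c \<odot>\<^bsub>B\<^esub> b)"
  by (simp_all add: alg_right_def)

lemma alg_left_simps [simp]:
  "carrier (alg_left B) = carrier B" "add (alg_left B) = add B" "zero (alg_left B) = zero B"
  "smult (alg_left B) = smult B" "rsmult (alg_left B) = monoid.mult B"
  by (simp_all add: alg_left_def)

lemma carrier_complex_ring [simp]: "carrier complex_ring = UNIV"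
  by (simp add: complex_ring_def)

lemma univ_forms1_simps [simp]:
  "carrier (univ_forms1 B) = {X \<in> carrier (alg_tensor B). tensor_lift B (monoid.mult B) X = \<zero>\<^bsub>B\<^esub>}"
  "add (univ_forms1 B) = add (alg_tensor B)" "zero (univ_forms1 B) = zero (alg_tensor B)"
  "smult (univ_forms1 B) = smult (alg_tensor B)" "rsmult (univ_forms1 B) = rsmult (alg_tensor B)"
  by (simp_all add: univ_forms1_def)

context complex_algebra
begin

text \<open>The unqualified names of ring facts denote those of the scalar ring, inherited from
  \<^locale>\<open>module\<close>.\<close>

lemma ring_A: "ring A" ..

lemmas abelian_group_A = ringE(1) [OF ring_A]
  and alg_l_distr = ringE(3) [OF ring_A]
  and alg_r_distr = ringE(4) [OF ring_A]
  and alg_assoc = monoid.m_assoc [OF ringE(2) [OF ring_A]]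
  and alg_r_neg = abelian_group.r_neg [OF ringE(1) [OF ring_A]]

text \<open>The rewrites replace the auxiliary records \<open>alg_right\<close> and
  \<open>alg_left\<close> by the operations of the algebra itself.\<close>

sublocale AT: tensor_pair complex_ring "alg_right A" "alg_left A"
  rewrites "tensor complex_ring (alg_right A) (alg_left A) = alg_tensor A"
    and "pure_tensor complex_ring (alg_right A) (alg_left A) = alg_pure A"
    and "carrier (alg_right A) = carrier A" and "carrier (alg_left A) = carrier A"
    and "add (alg_right A) = add A" and "add (alg_left A) = add A"
    and "rsmult (alg_right A) = (\<lambda>b c. c \<odot> b)" and "smult (alg_right A) = (\<otimes>)"
    and "smult (alg_left A) = (\<odot>)" and "rsmult (alg_left A) = (\<otimes>)"
proof -
  show "tensor_pair complex_ring (alg_right A) (alg_left A)"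
    by (intro tensor_pair.intro tensor_pair_axioms.intro)
      (auto intro: abelian_group_carrier_add_zero [OF abelian_group_A, of "alg_right A"]
        abelian_group_carrier_add_zero [OF abelian_group_A, of "alg_left A"])
qed (simp_all add: alg_tensor_def alg_pure_def)

lemma balanced_map_alg:
  "balanced_map complex_ring (alg_right A) (alg_left A) P f \<longleftrightarrow>
     (\<forall>a \<in> carrier A. \<forall>b \<in> carrier A. f a b \<in> carrier P) \<and>
     (\<forall>a \<in> carrier A. \<forall>a' \<in> carrier A. \<forall>b \<in> carrier A. f (a \<oplus> a') b = f a b \<oplus>\<^bsub>P\<^esub> f a' b) \<and>
     (\<forall>a \<in> carrier A. \<forall>b \<in> carrier A. \<forall>b' \<in> carrier A. f a (b \<oplus> b') = f a b \<oplus>\<^bsub>P\<^esub> f a b') \<and>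
     (\<forall>a \<in> carrier A. \<forall>c. \<forall>b \<in> carrier A. f (c \<odot> a) b = f a (c \<odot> b))"
  by (simp add: balanced_map_def)

text \<open>Scalars sit in the algebra as the central elements \<open>c \<odot> \<one>\<close>;
  \<open>cscale\<close> lets them act on bimodules in this form.\<close>

lemma scale_one:
  "a \<in> carrier A \<Longrightarrow> (c \<odot> \<one>) \<otimes> a = c \<odot> a" "a \<in> carrier A \<Longrightarrow> a \<otimes> (c \<odot> \<one>) = c \<odot> a"
  by (simp_all add: smult_mult_left smult_mult_right)

lemma alg_smult_eq_lift:
  assumes "a \<in> carrier A"
  shows "X \<in> carrier (alg_tensor A) \<Longrightarrow> a \<odot>\<^bsub>alg_tensor A\<^esub> X = tensor_lift (alg_tensor A) (\<lambda>b b'. alg_pure A (a \<otimes> b) b') X"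
    and "balanced_map complex_ring (alg_right A) (alg_left A) (alg_tensor A) (\<lambda>b b'. alg_pure A (a \<otimes> b) b')"
proof -
  show *: "balanced_map complex_ring (alg_right A) (alg_left A) (alg_tensor A) (\<lambda>b b'. alg_pure A (a \<otimes> b) b')"
    using assms(1) unfolding balanced_map_alg
    by (simp add: AT.pure_closed AT.pure_simps alg_r_distr smult_mult_right)
  show "a \<odot>\<^bsub>alg_tensor A\<^esub> X = tensor_lift (alg_tensor A) (\<lambda>b b'. alg_pure A (a \<otimes> b) b') X"
    if "X \<in> carrier (alg_tensor A)"
    using AT.smult_eq_lift [OF _ * that] assms by simp
qed

lemma alg_rsmult_eq_lift:
  assumes "a \<in> carrier A"
  shows "X \<in> carrier (alg_tensor A) \<Longrightarrow> X \<odot>\<^sub>r\<^bsub>alg_tensor A\<^esub> a = tensor_lift (alg_tensor A) (\<lambda>b b'. alg_pure A b (b' \<otimes> a)) X"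
    and "balanced_map complex_ring (alg_right A) (alg_left A) (alg_tensor A) (\<lambda>b b'. alg_pure A b (b' \<otimes> a))"
proof -
  show *: "balanced_map complex_ring (alg_right A) (alg_left A) (alg_tensor A) (\<lambda>b b'. alg_pure A b (b' \<otimes> a))"
    using assms(1) unfolding balanced_map_alg
    by (simp add: AT.pure_closed AT.pure_simps alg_l_distr smult_mult_left)
  show "X \<odot>\<^sub>r\<^bsub>alg_tensor A\<^esub> a = tensor_lift (alg_tensor A) (\<lambda>b b'. alg_pure A b (b' \<otimes> a)) X"
    if "X \<in> carrier (alg_tensor A)"
    using AT.rsmult_eq_lift [OF _ * that] assms by simp
qed

lemma alg_smult_hom:
  "a \<in> carrier A \<Longrightarrow> abelian_group_hom (alg_tensor A) (alg_tensor A) (smult (alg_tensor A) a)"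
  by (rule abelian_group_hom_cong [OF AT.tensor_lift_hom [OF AT.abelian_group_tensor alg_smult_eq_lift(2)]
        alg_smult_eq_lift(1)])

lemma alg_rsmult_hom:
  "a \<in> carrier A \<Longrightarrow> abelian_group_hom (alg_tensor A) (alg_tensor A) (\<lambda>X. X \<odot>\<^sub>r\<^bsub>alg_tensor A\<^esub> a)"
  by (rule abelian_group_hom_cong [OF AT.tensor_lift_hom [OF AT.abelian_group_tensor alg_rsmult_eq_lift(2)]
        alg_rsmult_eq_lift(1)])

lemma alg_smult_pure:
  "\<lbrakk>a \<in> carrier A; b \<in> carrier A; c \<in> carrier A\<rbrakk>
    \<Longrightarrow> a \<odot>\<^bsub>alg_tensor A\<^esub> alg_pure A b c = alg_pure A (a \<otimes> b) c"
  by (simp add: alg_smult_eq_lift(1) AT.pure_closed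
      AT.tensor_lift_pure [OF AT.abelian_group_tensor alg_smult_eq_lift(2)])

lemma alg_rsmult_pure:
  "\<lbrakk>a \<in> carrier A; b \<in> carrier A; c \<in> carrier A\<rbrakk>
    \<Longrightarrow> alg_pure A b c \<odot>\<^sub>r\<^bsub>alg_tensor A\<^esub> a = alg_pure A b (c \<otimes> a)"
  by (simp add: alg_rsmult_eq_lift(1) AT.pure_closed
      AT.tensor_lift_pure [OF AT.abelian_group_tensor alg_rsmult_eq_lift(2)])

lemma balanced_mult: "balanced_map complex_ring (alg_right A) (alg_left A) A (\<otimes>)"
  unfolding balanced_map_alg by (simp add: alg_l_distr alg_r_distr smult_mult_left smult_mult_right)

lemma alg_mult_hom: "abelian_group_hom (alg_tensor A) A (tensor_lift A (\<otimes>))"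
  by (rule AT.tensor_lift_hom [OF abelian_group_A balanced_mult])

lemma alg_mult_pure:
  "\<lbrakk>a \<in> carrier A; b \<in> carrier A\<rbrakk> \<Longrightarrow> tensor_lift A (\<otimes>) (alg_pure A a b) = a \<otimes> b"
  by (rule AT.tensor_lift_pure [OF abelian_group_A balanced_mult])

lemma left_mult_hom: "a \<in> carrier A \<Longrightarrow> abelian_group_hom A A (\<lambda>x. a \<otimes> x)"
  by (rule abelian_group_homI' [OF abelian_group_A abelian_group_A]) (auto simp: alg_r_distr)

lemma right_mult_hom: "a \<in> carrier A \<Longrightarrow> abelian_group_hom A A (\<lambda>x. x \<otimes> a)"
  by (rule abelian_group_homI' [OF abelian_group_A abelian_group_A]) (auto simp: alg_l_distr)

text \<open>On pure tensors both identities are associativity. They make the kernel of the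
  multiplication stable under both actions, which is what its tensor square over the algebra
  requires.\<close>

lemma alg_mult_smult:
  assumes "a \<in> carrier A" "X \<in> carrier (alg_tensor A)"
  shows "tensor_lift A (\<otimes>) (a \<odot>\<^bsub>alg_tensor A\<^esub> X) = a \<otimes> tensor_lift A (\<otimes>) X"
    and "tensor_lift A (\<otimes>) (X \<odot>\<^sub>r\<^bsub>alg_tensor A\<^esub> a) = tensor_lift A (\<otimes>) X \<otimes> a"
  using assms(1)
  by (intro AT.tensor_hom_eqI [OF abelian_group_hom_compose [OF alg_smult_hom alg_mult_hom]
        abelian_group_hom_compose [OF alg_mult_hom left_mult_hom] _ assms(2)]
      AT.tensor_hom_eqI [OF abelian_group_hom_compose [OF alg_rsmult_hom alg_mult_hom]
        abelian_group_hom_compose [OF alg_mult_hom right_mult_hom] _ assms(2)];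
      simp add: alg_smult_pure alg_rsmult_pure alg_mult_pure alg_assoc)+

lemma alg_tensor_smult_closed:
  assumes "a \<in> carrier A" "X \<in> carrier (alg_tensor A)"
  shows "a \<odot>\<^bsub>alg_tensor A\<^esub> X \<in> carrier (alg_tensor A)" "X \<odot>\<^sub>r\<^bsub>alg_tensor A\<^esub> a \<in> carrier (alg_tensor A)"
  using abelian_group_hom.hom_closed [OF alg_smult_hom] abelian_group_hom.hom_closed [OF alg_rsmult_hom]
    assms by auto

lemma abelian_group_univ_forms1: "abelian_group (univ_forms1 A)"
proof -
  interpret m: abelian_group_hom "alg_tensor A" A "tensor_lift A (\<otimes>)" by (rule alg_mult_hom)
  show ?thesis
  proof (rule abelian_groupI)
    fix X assume "X \<in> carrier (univ_forms1 A)"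
    then have "\<ominus>\<^bsub>alg_tensor A\<^esub> X \<in> carrier (univ_forms1 A)"
      and "\<ominus>\<^bsub>alg_tensor A\<^esub> X \<oplus>\<^bsub>univ_forms1 A\<^esub> X = \<zero>\<^bsub>univ_forms1 A\<^esub>"
      by (simp_all add: AT.T.l_neg)
    then show "\<exists>Y\<in>carrier (univ_forms1 A). Y \<oplus>\<^bsub>univ_forms1 A\<^esub> X = \<zero>\<^bsub>univ_forms1 A\<^esub>"
      by blast
  qed (auto simp: AT.T.a_ac)
qed

sublocale U: tensor_pair A "univ_forms1 A" "univ_forms1 A"
  rewrites "tensor A (univ_forms1 A) (univ_forms1 A) = univ_forms2 A"
proof -
  show "tensor_pair A (univ_forms1 A) (univ_forms1 A)"
    by (intro tensor_pair.intro tensor_pair_axioms.intro abelian_group_univ_forms1)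
      (auto simp: alg_tensor_smult_closed alg_mult_smult)
qed (simp add: univ_forms2_def)

lemma univ_d0_closed:
  assumes "a \<in> carrier A" shows "univ_d0 A a \<in> carrier (univ_forms1 A)"
proof -
  interpret m: abelian_group_hom "alg_tensor A" A "tensor_lift A (\<otimes>)" by (rule alg_mult_hom)
  show ?thesis
    using assms by (simp add: univ_d0_def AT.pure_closed AT.T.minus_eq alg_mult_pure alg_r_neg)
qed

lemma univ_d0_add:
  "\<lbrakk>a \<in> carrier A; b \<in> carrier A\<rbrakk>
    \<Longrightarrow> univ_d0 A (a \<oplus> b) = univ_d0 A a \<oplus>\<^bsub>alg_tensor A\<^esub> univ_d0 A b"
  by (simp add: univ_d0_def AT.pure_simps AT.pure_closed AT.T.minus_add_minus)

text \<open>A scalar is extracted once as a right factor and once as a left factor, ready to be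
  moved across a tensor sign over the algebra.\<close>

lemma univ_d0_scale:
  assumes "a \<in> carrier A"
  shows "univ_d0 A (c \<odot> a) = univ_d0 A a \<odot>\<^sub>r\<^bsub>alg_tensor A\<^esub> (c \<odot> \<one>)"
    and "univ_d0 A (c \<odot> a) = (c \<odot> \<one>) \<odot>\<^bsub>alg_tensor A\<^esub> univ_d0 A a"
proof -
  interpret l: abelian_group_hom "alg_tensor A" "alg_tensor A" "smult (alg_tensor A) (c \<odot> \<one>)"
    by (rule alg_smult_hom) simp
  interpret r: abelian_group_hom "alg_tensor A" "alg_tensor A" "\<lambda>X. X \<odot>\<^sub>r\<^bsub>alg_tensor A\<^esub> (c \<odot> \<one>)"
    by (rule alg_rsmult_hom) simp
  have "alg_pure A (c \<odot> b) b' = alg_pure A b (c \<odot> b')" if "b \<in> carrier A" "b' \<in> carrier A" for b b'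
    using that by (simp add: AT.pure_simps)
  note scale = this
  show "univ_d0 A (c \<odot> a) = univ_d0 A a \<odot>\<^sub>r\<^bsub>alg_tensor A\<^esub> (c \<odot> \<one>)"
    using assms by (simp add: univ_d0_def AT.T.minus_eq AT.pure_closed alg_rsmult_pure scale_one scale)
  show "univ_d0 A (c \<odot> a) = (c \<odot> \<one>) \<odot>\<^bsub>alg_tensor A\<^esub> univ_d0 A a"
    using assms by (simp add: univ_d0_def AT.T.minus_eq AT.pure_closed alg_smult_pure scale_one scale)
qed

text \<open>Balance over the complex numbers follows from balance over the algebra at
  \<open>c \<odot> \<one>\<close>: the scalar leaves the first \<delta> on the right, crosses the
  tensor sign and enters the second \<delta> from the left.\<close>

lemma balanced_univ_d1:
  "balanced_map complex_ring (alg_right A) (alg_left A) (univ_forms2 A)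
    (\<lambda>b b'. pure_tensor A (univ_forms1 A) (univ_forms1 A) (univ_d0 A b) (univ_d0 A b'))"
proof -
  note [simp del] = univ_forms1_simps(1)
  have "pure_tensor A (univ_forms1 A) (univ_forms1 A) (univ_d0 A (c \<odot> b)) (univ_d0 A b') =
      pure_tensor A (univ_forms1 A) (univ_forms1 A) (univ_d0 A b) (univ_d0 A (c \<odot> b'))"
    if "b \<in> carrier A" "b' \<in> carrier A" for b b' c
    using that U.pure_simps(3) [of "univ_d0 A b" "c \<odot> \<one>" "univ_d0 A b'"]
    by (simp add: univ_d0_closed univ_d0_scale(1) [of b] univ_d0_scale(2) [of b'])
  moreover note univ_d0_closed
  ultimately show ?thesis
    unfolding balanced_map_alg
    using U.pure_simps(1,2) by (simp add: U.pure_closed univ_d0_add)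
qed

lemma univ_d1_hom: "abelian_group_hom (alg_tensor A) (univ_forms2 A) (univ_d1 A)"
  unfolding univ_d1_def by (rule AT.tensor_lift_hom [OF U.abelian_group_tensor balanced_univ_d1])

lemma univ_d1_pure:
  "\<lbrakk>a \<in> carrier A; b \<in> carrier A\<rbrakk> \<Longrightarrow> univ_d1 A (alg_pure A a b) =
    pure_tensor A (univ_forms1 A) (univ_forms1 A) (univ_d0 A a) (univ_d0 A b)"
  unfolding univ_d1_def by (rule AT.tensor_lift_pure [OF U.abelian_group_tensor balanced_univ_d1])

end

section \<open>First order calculi\<close>

context first_order_calculus
begin

lemma abelian_group_M: "abelian_group M" ..

lemma d_in_M: "b \<in> carrier B \<Longrightarrow> d b \<in> carrier M"
  using d_closed by auto

sublocale MM: tensor_pair B M M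
  by (intro tensor_pair.intro tensor_pair_axioms.intro abelian_group_M) (auto simp: rsmult_closed lsmult_closed)

lemma balanced_univ_proj1:
  "balanced_map complex_ring (alg_right B) (alg_left B) M (\<lambda>b b'. b \<odot>\<^bsub>M\<^esub> d b')"
proof -
  have "c \<odot>\<^bsub>B\<^esub> a \<odot>\<^bsub>M\<^esub> d b = a \<odot>\<^bsub>M\<^esub> d (c \<odot>\<^bsub>B\<^esub> b)" if "a \<in> carrier B" "b \<in> carrier B" for a b c
  proof -
    have "c \<odot>\<^bsub>B\<^esub> a \<odot>\<^bsub>M\<^esub> d b = (a \<otimes>\<^bsub>B\<^esub> (c \<odot>\<^bsub>B\<^esub> \<one>\<^bsub>B\<^esub>)) \<odot>\<^bsub>M\<^esub> d b"
      using that by (simp add: scale_one)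
    also have "\<dots> = a \<odot>\<^bsub>M\<^esub> d (c \<odot>\<^bsub>B\<^esub> b)"
      using that d_in_M by (simp add: lsmult_assoc d_scale cscale_def)
    finally show ?thesis .
  qed
  then show ?thesis
    unfolding balanced_map_alg
    by (simp add: d_in_M lsmult_closed lsmult_add_left lsmult_add_right d_add)
qed

lemma univ_proj1_hom: "abelian_group_hom (alg_tensor B) M (univ_proj1 M d)"
  unfolding univ_proj1_def by (rule AT.tensor_lift_hom [OF abelian_group_M balanced_univ_proj1])

lemma univ_proj1_pure:
  "\<lbrakk>a \<in> carrier B; b \<in> carrier B\<rbrakk> \<Longrightarrow> univ_proj1 M d (alg_pure B a b) = a \<odot>\<^bsub>M\<^esub> d b"
  unfolding univ_proj1_def by (rule AT.tensor_lift_pure [OF abelian_group_M balanced_univ_proj1])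

lemma univ_proj1_closed: "X \<in> carrier (alg_tensor B) \<Longrightarrow> univ_proj1 M d X \<in> carrier M"
  by (rule abelian_group_hom.hom_closed [OF univ_proj1_hom])

lemma lsmult_hom: "a \<in> carrier B \<Longrightarrow> abelian_group_hom M M (smult M a)"
  by (rule abelian_group_homI' [OF abelian_group_M abelian_group_M]) (auto simp: lsmult_closed lsmult_add_right)

lemma rsmult_hom: "a \<in> carrier B \<Longrightarrow> abelian_group_hom M M (\<lambda>m. m \<odot>\<^sub>r\<^bsub>M\<^esub> a)"
  by (rule abelian_group_homI' [OF abelian_group_M abelian_group_M]) (auto simp: rsmult_closed rsmult_add_left)

lemma evaluation_hom: "m \<in> carrier M \<Longrightarrow> abelian_group_hom B M (\<lambda>a. a \<odot>\<^bsub>M\<^esub> m)"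
  by (rule abelian_group_homI' [OF abelian_group_A abelian_group_M]) (auto simp: lsmult_closed lsmult_add_left)

lemma lsmult_zero: "m \<in> carrier M \<Longrightarrow> \<zero>\<^bsub>B\<^esub> \<odot>\<^bsub>M\<^esub> m = \<zero>\<^bsub>M\<^esub>"
  using abelian_group_hom.hom_zero [OF evaluation_hom] by simp

lemma univ_proj1_smult:
  assumes "a \<in> carrier B" "X \<in> carrier (alg_tensor B)"
  shows "univ_proj1 M d (a \<odot>\<^bsub>alg_tensor B\<^esub> X) = a \<odot>\<^bsub>M\<^esub> univ_proj1 M d X"
  by (rule AT.tensor_hom_eqI [OF abelian_group_hom_compose [OF alg_smult_hom univ_proj1_hom]
        abelian_group_hom_compose [OF univ_proj1_hom lsmult_hom] _ assms(2)])
    (use assms(1) d_in_M in \<open>simp_all add: alg_smult_pure univ_proj1_pure lsmult_assoc\<close>)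

text \<open>The term \<open>m(X) da\<close>, with \<open>m\<close> the multiplication of \<open>B\<close>, is why \<open>\<pi>\<close> is right linear only
  on the kernel of \<open>m\<close>.\<close>

lemma univ_proj1_rsmult:
  assumes "a \<in> carrier B" "X \<in> carrier (alg_tensor B)"
  shows "univ_proj1 M d (X \<odot>\<^sub>r\<^bsub>alg_tensor B\<^esub> a)
    = univ_proj1 M d X \<odot>\<^sub>r\<^bsub>M\<^esub> a \<oplus>\<^bsub>M\<^esub> tensor_lift B (monoid.mult B) X \<odot>\<^bsub>M\<^esub> d a"
  by (rule AT.tensor_hom_eqI [OF abelian_group_hom_compose [OF alg_rsmult_hom univ_proj1_hom]
        abelian_group_hom_add [OF abelian_group_hom_compose [OF univ_proj1_hom rsmult_hom]
          abelian_group_hom_compose [OF alg_mult_hom evaluation_hom]] _ assms(2)])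
    (use assms(1) d_in_M in \<open>simp_all add: alg_rsmult_pure univ_proj1_pure alg_mult_pure d_Leibniz
      lsmult_add_right rsmult_closed lsmult_closed lsmult_assoc lsmult_rsmult\<close>)

lemma univ_proj1_rsmult_forms:
  assumes "a \<in> carrier B" "X \<in> carrier (univ_forms1 B)"
  shows "univ_proj1 M d (X \<odot>\<^sub>r\<^bsub>alg_tensor B\<^esub> a) = univ_proj1 M d X \<odot>\<^sub>r\<^bsub>M\<^esub> a"
  using assms by (simp add: univ_proj1_rsmult lsmult_zero d_in_M univ_proj1_closed rsmult_closed)

text \<open>Needed because \<delta>(b) contains the term \<open>b \<otimes> 1\<close>, which \<pi>
  sends to a multiple of \<open>d 1\<close>.\<close>

lemma d_one: "d \<one>\<^bsub>B\<^esub> = \<zero>\<^bsub>M\<^esub>"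
proof -
  have "d \<one>\<^bsub>B\<^esub> = d \<one>\<^bsub>B\<^esub> \<oplus>\<^bsub>M\<^esub> d \<one>\<^bsub>B\<^esub>"
    using d_Leibniz [of "\<one>\<^bsub>B\<^esub>" "\<one>\<^bsub>B\<^esub>"] d_in_M by (simp add: lsmult_one rsmult_one)
  then show ?thesis
    using group.r_cancel_one' [OF abelian_group.a_group [OF abelian_group_M], of "d \<one>\<^bsub>B\<^esub>" "d \<one>\<^bsub>B\<^esub>"] d_in_M by simp
qed

lemma univ_proj1_d0:
  assumes "b \<in> carrier B"
  shows "univ_proj1 M d (univ_d0 B b) = d b"
proof -
  interpret p: abelian_group_hom "alg_tensor B" M "univ_proj1 M d" by (rule univ_proj1_hom)
  interpret l: abelian_group_hom M M "smult M b" using assms by (rule lsmult_hom)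
  show ?thesis
    using assms
    by (simp add: univ_d0_def AT.T.minus_eq AT.pure_closed univ_proj1_pure d_one lsmult_one d_in_M)
qed

text \<open>A form \<open>b dc\<close> is the image of \<open>b \<delta>(c)\<close>, which lies in
  the kernel of the multiplication because \<delta>(c) does; sums and negatives of lifts are again
  lifts.\<close>

lemma univ_proj1_surj:
  assumes "\<omega> \<in> carrier M"
  shows "\<exists>X \<in> carrier (univ_forms1 B). univ_proj1 M d X = \<omega>"
proof -
  interpret m: abelian_group_hom "alg_tensor B" B "tensor_lift B (monoid.mult B)" by (rule alg_mult_hom)
  interpret p: abelian_group_hom "alg_tensor B" M "univ_proj1 M d" by (rule univ_proj1_hom)
  have base: "\<exists>X \<in> carrier (univ_forms1 B). univ_proj1 M d X = b \<odot>\<^bsub>M\<^esub> d c"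
    if "b \<in> carrier B" "c \<in> carrier B" for b c
    using that univ_d0_closed [of c]
    by (intro bexI [of _ "b \<odot>\<^bsub>alg_tensor B\<^esub> univ_d0 B c"])
      (simp_all add: univ_proj1_smult univ_proj1_d0 alg_tensor_smult_closed alg_mult_smult)
  have "\<omega> \<in> generate (add_monoid M) {b \<odot>\<^bsub>M\<^esub> d c | b c. b \<in> carrier B \<and> c \<in> carrier B}"
    using assms span by (rule subst [of _ _ "\<lambda>S. \<omega> \<in> S", rotated])
  then show ?thesis
  proof (induction rule: generate.induct)
    case one
    then show ?case by (intro bexI [of _ "\<zero>\<^bsub>alg_tensor B\<^esub>"]) auto
  next
    case (incl h)
    then show ?case using base by auto
  next
    case (inv h)
    then obtain X where "X \<in> carrier (univ_forms1 B)" "univ_proj1 M d X = h"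
      using base by auto
    then show ?case
      by (intro bexI [of _ "\<ominus>\<^bsub>alg_tensor B\<^esub> X"]) (auto simp: a_inv_def [of M, symmetric])
  next
    case (eng h1 h2)
    then obtain X Y where "X \<in> carrier (univ_forms1 B)" "univ_proj1 M d X = h1"
      "Y \<in> carrier (univ_forms1 B)" "univ_proj1 M d Y = h2" by auto
    then show ?case
      by (intro bexI [of _ "X \<oplus>\<^bsub>alg_tensor B\<^esub> Y"]) auto
  qed
qed

text \<open>A factor \<open>a\<close> travels by \<pi>(x a) = \<pi>(x) a, then across the tensor
  sign, then by a \<pi>(y) = \<pi>(a y). The first equality uses that \<open>x\<close> is in the
  kernel of the multiplication.\<close>

lemma balanced_univ_proj2:
  "balanced_map B (univ_forms1 B) (univ_forms1 B) (tensor B M M)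
    (\<lambda>x y. pure_tensor B M M (univ_proj1 M d x) (univ_proj1 M d y))"
proof -
  interpret p: abelian_group_hom "alg_tensor B" M "univ_proj1 M d" by (rule univ_proj1_hom)
  show ?thesis
    unfolding balanced_map_def
    by (auto simp: MM.pure_closed MM.pure_simps univ_proj1_smult univ_proj1_rsmult_forms)
qed

lemma univ_proj2_hom: "abelian_group_hom (univ_forms2 B) (tensor B M M) (univ_proj2 B M d)"
  unfolding univ_proj2_def by (rule U.tensor_lift_hom [OF MM.abelian_group_tensor balanced_univ_proj2])

text \<open>The composite is additive on the whole tensor square and not only on the kernel, hence
  accessible through pure tensors.\<close>

lemma univ_proj2_d1_hom:
  "abelian_group_hom (alg_tensor B) (tensor B M M) (\<lambda>X. univ_proj2 B M d (univ_d1 B X))"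
  by (rule abelian_group_hom_compose [OF univ_d1_hom univ_proj2_hom])

lemma univ_proj2_d1_pure:
  assumes "a \<in> carrier B" "b \<in> carrier B"
  shows "univ_proj2 B M d (univ_d1 B (alg_pure B a b)) = pure_tensor B M M (d a) (d b)"
  unfolding univ_d1_pure [OF assms] univ_proj2_def
  by (simp only: assms univ_proj1_d0 univ_d0_closed
      U.tensor_lift_pure [OF MM.abelian_group_tensor balanced_univ_proj2])

end

section \<open>Differential calculi\<close>

lemma form_bimodule_simps [simp]:
  "carrier (form_bimodule W \<Omega> k) = \<Omega> k" "add (form_bimodule W \<Omega> k) = add W"
  "zero (form_bimodule W \<Omega> k) = \<zero>\<^bsub>W\<^esub>" "smult (form_bimodule W \<Omega> k) = monoid.mult W"
  "rsmult (form_bimodule W \<Omega> k) = monoid.mult W"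
  by (simp_all add: form_bimodule_def)

context differential_calculus
begin

lemma B_simps:
  "carrier B = \<Omega> 0" "add B = add W" "zero B = \<zero>" "monoid.mult B = (\<otimes>)" "one B = \<one>" "smult B = (\<odot>)"
  by (simp_all add: degree_0)

lemma degree_subgroup: "subgroup (\<Omega> k) (add_monoid W)"
  using subspace by (rule submodule.axioms)

lemma degree_closed:
  "x \<in> \<Omega> k \<Longrightarrow> x \<in> carrier W" "\<zero> \<in> \<Omega> k" "\<lbrakk>x \<in> \<Omega> k; y \<in> \<Omega> k\<rbrakk> \<Longrightarrow> x \<oplus> y \<in> \<Omega> k"
  "x \<in> \<Omega> k \<Longrightarrow> \<ominus> x \<in> \<Omega> k" "x \<in> \<Omega> k \<Longrightarrow> c \<odot> x \<in> \<Omega> k"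
  using subgroup.subset [OF degree_subgroup] subgroup.one_closed [OF degree_subgroup]
    subgroup.m_closed [OF degree_subgroup] subgroup.m_inv_closed [OF degree_subgroup]
    submodule.smult_closed [OF subspace, of c x k]
  by (auto simp: a_inv_def)

lemma one_degree_0: "\<one> \<in> \<Omega> 0"
  using monoid.one_closed [OF ringE(2) [OF base.ring_A]] by (simp add: B_simps)

lemma degree_mult:
  "\<lbrakk>x \<in> \<Omega> 0; y \<in> \<Omega> k\<rbrakk> \<Longrightarrow> x \<otimes> y \<in> \<Omega> k" "\<lbrakk>x \<in> \<Omega> k; y \<in> \<Omega> 0\<rbrakk> \<Longrightarrow> x \<otimes> y \<in> \<Omega> k"
  using graded [of x 0 y k] graded [of x k y 0] by auto

lemma abelian_group_forms: "abelian_group (form_bimodule W \<Omega> k)"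
proof (rule abelian_groupI)
  fix x assume "x \<in> carrier (form_bimodule W \<Omega> k)"
  then have "\<ominus> x \<in> carrier (form_bimodule W \<Omega> k)" "\<ominus> x \<oplus>\<^bsub>form_bimodule W \<Omega> k\<^esub> x = \<zero>\<^bsub>form_bimodule W \<Omega> k\<^esub>"
    using degree_closed abelian_group.l_neg [OF abelian_group_A] by auto
  then show "\<exists>y\<in>carrier (form_bimodule W \<Omega> k). y \<oplus>\<^bsub>form_bimodule W \<Omega> k\<^esub> x = \<zero>\<^bsub>form_bimodule W \<Omega> k\<^esub>"
    by blast
qed (use degree_closed abelian_groupE [OF abelian_group_A] in \<open>auto simp: subset_iff\<close>)

lemma complex_bimodule_forms: "complex_bimodule B (form_bimodule W \<Omega> k)"
proof (intro complex_bimodule.intro bimodule.intro complex_bimodule_axioms.intro bimodule_axioms.intro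
    base.complex_algebra_axioms base.ring_A abelian_group_forms)
qed (auto simp: B_simps degree_mult degree_closed alg_l_distr alg_r_distr alg_assoc scale_one one_degree_0)

section \<open>Forms of degree one as sums of \<open>b dc\<close>\<close>

abbreviation "exact_multiples \<equiv> {b \<otimes> d c | b c. b \<in> \<Omega> 0 \<and> c \<in> \<Omega> 0}"

lemma exact_multiples_degree: "exact_multiples \<subseteq> \<Omega> 1"
proof safe
  fix b c assume "b \<in> \<Omega> 0" "c \<in> \<Omega> 0"
  then show "b \<otimes> d c \<in> \<Omega> 1"
    using degree_mult(1) d_degree [of c 0] by simp
qed

lemma exact_multiples_carrier: "exact_multiples \<subseteq> carrier W"
  using exact_multiples_degree degree_closed(1) by blast

lemma d_mult: "\<lbrakk>a \<in> \<Omega> 0; b \<in> \<Omega> 0\<rbrakk> \<Longrightarrow> d (a \<otimes> b) = d a \<otimes> b \<oplus> a \<otimes> d b"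
  using graded_Leibniz [of a 0 b] degree_closed(1) by simp

lemma d_carrier: "b \<in> \<Omega> 0 \<Longrightarrow> d b \<in> carrier W"
  by (rule degree_closed(1) [OF d_degree])

lemma exact_span_left:
  assumes "a \<in> \<Omega> 0" "x \<in> generate (add_monoid W) exact_multiples"
  shows "a \<otimes> x \<in> generate (add_monoid W) exact_multiples"
proof (rule abelian_group_hom.hom_generate
    [OF left_mult_hom exact_multiples_carrier exact_multiples_carrier _ assms(2)])
  show "a \<in> carrier W" using assms(1) degree_closed(1) by blast
  fix x assume "x \<in> exact_multiples"
  then obtain b c where bc: "x = b \<otimes> d c" "b \<in> \<Omega> 0" "c \<in> \<Omega> 0" by blast
  then have "a \<otimes> x = (a \<otimes> b) \<otimes> d c"
    using assms(1) d_degree degree_closed(1) by (metis alg_assoc)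
  then show "a \<otimes> x \<in> generate (add_monoid W) exact_multiples"
    using bc assms(1) degree_mult by (intro generate.incl) blast
qed

text \<open>A factor on the right is moved to the left by the Leibniz rule: (b dc) a = b d(ca) -
  (bc) da. The sign is absorbed into the coefficient \<open>bc\<close>, which leaves a sum of two
  generators.\<close>

lemma exact_span_right:
  assumes "a \<in> \<Omega> 0" "x \<in> generate (add_monoid W) exact_multiples"
  shows "x \<otimes> a \<in> generate (add_monoid W) exact_multiples"
proof (rule abelian_group_hom.hom_generate
    [OF right_mult_hom exact_multiples_carrier exact_multiples_carrier _ assms(2)])
  show a: "a \<in> carrier W" using assms(1) degree_closed(1) by blast
  fix x assume "x \<in> exact_multiples"
  then obtain b c where bc: "x = b \<otimes> d c" "b \<in> \<Omega> 0" "c \<in> \<Omega> 0" by blast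
  have carr: "b \<in> carrier W" "c \<in> carrier W" "d c \<in> carrier W" "d a \<in> carrier W"
    using bc assms(1) degree_closed(1) d_degree by blast+
  have "b \<otimes> d (c \<otimes> a) \<oplus> (\<ominus> (b \<otimes> c)) \<otimes> d a
      = (x \<otimes> a \<oplus> (b \<otimes> c) \<otimes> d a) \<oplus> \<ominus> ((b \<otimes> c) \<otimes> d a)"
    using bc carr a assms(1)
    by (simp add: d_mult alg_r_distr alg_assoc ring.l_minus [OF ring_A])
  also have "\<dots> = x \<otimes> a"
    using bc carr a by (simp add: abelian_monoid.a_assoc [OF abelian_group.axioms(1) [OF abelian_group_A]]
        abelian_group.r_neg [OF abelian_group_A])
  finally have eq: "x \<otimes> a = b \<otimes> d (c \<otimes> a) \<oplus> (\<ominus> (b \<otimes> c)) \<otimes> d a" ..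
  have "b \<otimes> d (c \<otimes> a) \<in> exact_multiples" "(\<ominus> (b \<otimes> c)) \<otimes> d a \<in> exact_multiples"
    using bc assms(1) degree_mult degree_closed(4) by blast+
  then show "x \<otimes> a \<in> generate (add_monoid W) exact_multiples"
    unfolding eq using generate.eng [OF generate.incl generate.incl, where G = "add_monoid W"] by simp
qed

text \<open>Replacing \<open>\<Omega>\<^sup>1\<close> by the span of the \<open>b dc\<close> gives a graded subalgebra that contains \<open>B\<close> and \<open>dB\<close>,
  hence everything.\<close>

lemma degree_1_eq: "\<Omega> 1 = generate (add_monoid W) exact_multiples"
proof
  let ?N = "generate (add_monoid W) exact_multiples"
  show N: "?N \<subseteq> \<Omega> 1"
    by (rule group.generate_subgroup_incl [OF abelian_group.a_group [OF abelian_group_A]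
          exact_multiples_degree degree_subgroup])
  \<comment> \<open>Only the component of degree one is changed.\<close>
  define S where "S = \<Omega>(1 := ?N)"
  have S_subgroup: "subgroup (S k) (add_monoid W)" for k
    using degree_subgroup group.generate_is_subgroup [OF abelian_group.a_group [OF abelian_group_A]]
      exact_multiples_carrier
    by (simp add: S_def)
  have S_degree: "x \<in> \<Omega> k" if "x \<in> S k" for x k
    using that N by (auto simp: S_def split: if_splits)
  let ?U = "\<Union>k. S k"
  let ?G = "generate (add_monoid W) ?U"
  have U: "?U \<subseteq> carrier W"
    using S_degree degree_closed(1) by blast
  \<comment> \<open>Products of total degree other than 1 land in an unchanged component. In total
    degree 1 one factor has degree 0 and the other lies in the span, which is stable under
    \<open>\<Omega> 0\<close> on both sides.\<close>
  have U_mult: "x \<otimes> y \<in> ?U" if "x \<in> ?U" "y \<in> ?U" for x y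
  proof -
    from that obtain i j where x: "x \<in> S i" and y: "y \<in> S j" by blast
    then have xy: "x \<otimes> y \<in> \<Omega> (i + j)"
      by (intro graded S_degree)
    show ?thesis
    proof (cases "i + j = 1")
      case True
      then have "i = 0 \<and> j = 1 \<or> i = 1 \<and> j = 0" by arith
      then have "x \<otimes> y \<in> S 1"
        using x y exact_span_left exact_span_right by (auto simp: S_def)
      then show ?thesis by blast
    next
      case False
      then have "x \<otimes> y \<in> S (i + j)" using xy by (simp add: S_def)
      then show ?thesis by blast
    qed
  qed
  have G_carrier: "?G \<subseteq> carrier W"
    using group.generate_incl [OF abelian_group.a_group [OF abelian_group_A], of ?U] U by simp
  \<comment> \<open>Closure under products is obtained one factor at a time: here the right factor
    is homogeneous, next it becomes arbitrary.\<close>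
  have G_mult1: "x \<otimes> y \<in> ?G" if "x \<in> ?G" "y \<in> ?U" for x y
    using that(2) U
    by (intro abelian_group_hom.hom_generate [OF right_mult_hom U U _ that(1)] generate.incl U_mult)
      (erule subsetD)
  have G_mult: "x \<otimes> y \<in> ?G" if "x \<in> ?G" "y \<in> ?G" for x y
    using that(1) G_carrier
    by (intro abelian_group_hom.hom_generate [OF left_mult_hom U U _ that(2)] G_mult1) (rule subsetD)
  have Omega0: "\<Omega> 0 \<subseteq> ?G"
  proof
    fix x assume "x \<in> \<Omega> 0"
    then have "x \<in> S 0" by (simp add: S_def)
    then show "x \<in> ?G" by (intro generate.incl UN_I UNIV_I)
  qed
  have G_subgroup: "subgroup ?G (add_monoid W)"
    using group.generate_is_subgroup [OF abelian_group.a_group [OF abelian_group_A], of ?U] U by simp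
  have "subring ?G W"
    by (intro subring.intro submonoid.intro G_subgroup G_carrier G_mult subsetD [OF Omega0 one_degree_0])
  moreover have "submodule ?G complex_ring W"
  proof (intro submodule.intro G_subgroup submodule_axioms.intro)
    fix c x assume "x \<in> ?G"
    \<comment> \<open>Complex multiples are products with \<open>c \<odot> \<one>\<close>, which has
      degree 0.\<close>
    moreover have "c \<odot> \<one> \<in> ?G"
      using Omega0 degree_closed(5) one_degree_0 by blast
    ultimately have "(c \<odot> \<one>) \<otimes> x \<in> ?G" by (intro G_mult)
    moreover have "x \<in> carrier W"
      using \<open>x \<in> ?G\<close> G_carrier by blast
    ultimately show "c \<odot> x \<in> ?G"
      by (simp only: scale_one(1))
  qed
  moreover have "carrier B \<union> d ` carrier B \<subseteq> ?G"
  proof -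
    have "d b \<in> ?U" if "b \<in> \<Omega> 0" for b
    proof -
      have "d b = \<one> \<otimes> d b"
        using monoid.l_one [OF ringE(2) [OF ring_A]] degree_closed(1) d_degree that by metis
      then have "d b \<in> exact_multiples"
        using that one_degree_0 by blast
      then have "d b \<in> S 1"
        unfolding S_def fun_upd_same by (rule generate.incl)
      then show ?thesis by blast
    qed
    then have "d ` \<Omega> 0 \<subseteq> ?G" by (intro image_subsetI generate.incl)
    then show ?thesis
      using Omega0 unfolding B_simps by (rule Un_least [rotated])
  qed
  ultimately have G: "?G = carrier W" by (rule generated)
  show "\<Omega> 1 \<subseteq> ?N"
  proof
    fix w assume w: "w \<in> \<Omega> 1"
    then have "w \<in> ?G" using G degree_closed(1) by blast
    then obtain f where f: "\<And>k. f k \<in> S k" "finite {k. f k \<noteq> \<zero>}" "w = (\<Oplus>k \<in> {k. f k \<noteq> \<zero>}. f k)"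
      using abelian_group.generate_graded [OF abelian_group_A, of S w, OF S_subgroup] by metis
    \<comment> \<open>The obvious decomposition of \<open>w\<close>, concentrated in degree 1. Since
      \<open>f\<close> is also a decomposition with respect to \<Omega>, uniqueness yields
      \<open>f = g\<close>, so that \<open>w = f 1\<close> lies in the span.\<close>
    define g where "g k = (if k = 1 then w else \<zero>)" for k :: nat
    have w_carrier: "w \<in> carrier W" using w by (rule degree_closed(1))
    note add_monoid_W = abelian_group.axioms(1) [OF abelian_group_A]
    have "finite {k. g k \<noteq> \<zero>} \<and> w = (\<Oplus>k \<in> {k. g k \<noteq> \<zero>}. g k)"
    proof (cases "w = \<zero>")
      case True
      then have "{k. g k \<noteq> \<zero>} = {}" by (simp add: g_def)
      then show ?thesis
        using True by (simp add: abelian_monoid.finsum_empty [OF add_monoid_W])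
    next
      case False
      then have "{k. g k \<noteq> \<zero>} = {1}" by (auto simp: g_def)
      moreover have "(\<Oplus>k \<in> {1}. g k) = w"
        using w_carrier by (simp add: g_def abelian_monoid.finsum_insert [OF add_monoid_W]
            abelian_monoid.finsum_empty [OF add_monoid_W] abelian_monoid.r_zero [OF add_monoid_W])
      ultimately show ?thesis by simp
    qed
    moreover have "g k \<in> \<Omega> k" for k
      using w degree_closed(2) by (simp add: g_def)
    ultimately have "f = g"
      using direct_sum [of w] w degree_closed(1) f S_degree by blast
    then show "w \<in> ?N"
      using f(1) [of 1] by (simp add: g_def S_def)
  qed
qed

lemma first_order_calculus_forms: "first_order_calculus B (form_bimodule W \<Omega> 1) d"
proof (intro first_order_calculus.intro first_order_calculus_axioms.intro complex_bimodule_forms)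
  interpret M: abelian_group "form_bimodule W \<Omega> 1" by (rule abelian_group_forms)
  \<comment> \<open>The span is known inside the additive group of \<open>W\<close> but is required
    inside that of the forms of degree one. The inverse in a group refers to its carrier, so the two
    inverses have to be compared.\<close>
  have inv_eq: "inv\<^bsub>add_monoid (form_bimodule W \<Omega> 1)\<^esub> x = inv\<^bsub>add_monoid W\<^esub> x" if "x \<in> \<Omega> 1" for x
    unfolding a_inv_def [symmetric] using that degree_closed abelian_group.l_neg [OF abelian_group_A]
    by (intro M.minus_equality) auto
  show "carrier (form_bimodule W \<Omega> 1) = generate (add_monoid (form_bimodule W \<Omega> 1))
      {b \<odot>\<^bsub>form_bimodule W \<Omega> 1\<^esub> d c | b c. b \<in> carrier B \<and> c \<in> carrier B}"
  proof
    show "carrier (form_bimodule W \<Omega> 1) \<subseteq> generate (add_monoid (form_bimodule W \<Omega> 1))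
      {b \<odot>\<^bsub>form_bimodule W \<Omega> 1\<^esub> d c | b c. b \<in> carrier B \<and> c \<in> carrier B}" (is "_ \<subseteq> ?N")
    proof
      fix w assume "w \<in> carrier (form_bimodule W \<Omega> 1)"
      then have "w \<in> generate (add_monoid W) exact_multiples"
        using degree_1_eq by simp
      then show "w \<in> ?N"
      proof (induction rule: generate.induct)
        case one
        show ?case using generate.one [of "add_monoid (form_bimodule W \<Omega> 1)"] by simp
      next
        case (incl x)
        then show ?case by (intro generate.incl) (simp add: B_simps)
      next
        case (inv x)
        then have "x \<in> \<Omega> 1" using exact_multiples_degree by blast
        with inv show ?case
          unfolding inv_eq [OF \<open>x \<in> \<Omega> 1\<close>, symmetric]
          by (intro generate.inv) (simp add: B_simps)
      next
        case (eng x y)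
        then show ?case using generate.eng [OF eng(3,4)] by simp
      qed
    qed
    show "?N \<subseteq> carrier (form_bimodule W \<Omega> 1)"
      using group.generate_incl [OF M.a_group] exact_multiples_degree by (simp add: B_simps)
  qed
qed (use degree_closed(1) [of _ 0] d_degree [of _ 0] in
  \<open>auto simp: B_simps d_add d_scale d_mult d_carrier cscale_def scale_one\<close>)

sublocale forms: first_order_calculus B "form_bimodule W \<Omega> 1" d
  by (rule first_order_calculus_forms)

abbreviation "T \<equiv> tensor B (form_bimodule W \<Omega> 1) (form_bimodule W \<Omega> 1)"

text \<open>Balance over \<open>B\<close> is associativity in \<open>W\<close>, since all actions
  are the product of \<open>W\<close>.\<close>

lemma balanced_wedge:
  "balanced_map B (form_bimodule W \<Omega> 1) (form_bimodule W \<Omega> 1) (form_bimodule W \<Omega> 2) (\<otimes>)"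
proof -
  have "x \<otimes> y \<in> \<Omega> 2" if "x \<in> \<Omega> 1" "y \<in> \<Omega> 1" for x y
    using graded [OF that] by (simp add: numeral_2_eq_2)
  then show ?thesis
    unfolding balanced_map_def
    using degree_closed(1) [of _ 0] degree_closed(1) [of _ 1]
    by (simp add: B_simps alg_l_distr alg_r_distr alg_assoc)
qed

lemma wedge_hom: "abelian_group_hom T (form_bimodule W \<Omega> 2) (wedge W \<Omega>)"
  unfolding wedge_def by (rule forms.MM.tensor_lift_hom [OF abelian_group_forms balanced_wedge])

lemma wedge_pure:
  "\<lbrakk>x \<in> \<Omega> 1; y \<in> \<Omega> 1\<rbrakk>
    \<Longrightarrow> wedge W \<Omega> (pure_tensor B (form_bimodule W \<Omega> 1) (form_bimodule W \<Omega> 1) x y) = x \<otimes> y"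
  unfolding wedge_def by (rule forms.MM.tensor_lift_pure [OF abelian_group_forms balanced_wedge]) simp_all

lemma wedge_closed: "X \<in> carrier T \<Longrightarrow> wedge W \<Omega> X \<in> \<Omega> 2"
  using abelian_group_hom.hom_closed [OF wedge_hom] by simp

lemma d_hom: "abelian_group_hom (form_bimodule W \<Omega> 1) (form_bimodule W \<Omega> 2) d"
  using d_degree [of _ 1] degree_closed(1) [of _ 1]
  by (intro abelian_group_homI' abelian_group_forms) (simp_all add: d_add numeral_2_eq_2)

lemma wedge_univ_proj2_d1:
  assumes "X \<in> carrier (alg_tensor B)"
  shows "wedge W \<Omega> (univ_proj2 B (form_bimodule W \<Omega> 1) d (univ_d1 B X))
    = d (univ_proj1 (form_bimodule W \<Omega> 1) d X)"
proof (rule base.AT.tensor_hom_eqI [OF abelian_group_hom_compose [OF forms.univ_proj2_d1_hom wedge_hom]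
      abelian_group_hom_compose [OF forms.univ_proj1_hom d_hom] _ assms])
  fix a b assume B: "a \<in> carrier B" "b \<in> carrier B"
  then have ab: "a \<in> \<Omega> 0" "b \<in> \<Omega> 0" by (simp_all add: B_simps)
  \<comment> \<open>\<open>a\<close> has even degree, so the sign is plus, and the second summand
    dies by \<open>d_d\<close>.\<close>
  have "d (a \<otimes> d b) = d a \<otimes> d b \<oplus> a \<otimes> d (d b)"
    using graded_Leibniz [OF ab(1) d_carrier [OF ab(2)]] by simp
  also have "\<dots> = d a \<otimes> d b"
    using ab d_carrier degree_closed(1) [of _ 0] abelian_group_hom.hom_zero [OF left_mult_hom]
      abelian_monoid.r_zero [OF abelian_group.axioms(1) [OF abelian_group_A]]
      monoid.m_closed [OF ringE(2) [OF ring_A]]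
    by (simp add: d_d)
  finally show "wedge W \<Omega> (univ_proj2 B (form_bimodule W \<Omega> 1) d (univ_d1 B (alg_pure B a b)))
      = d (univ_proj1 (form_bimodule W \<Omega> 1) d (alg_pure B a b))"
    using d_degree [OF ab(1)] d_degree [OF ab(2)]
    unfolding forms.univ_proj2_d1_pure [OF B] forms.univ_proj1_pure [OF B]
    by (simp add: wedge_pure del: One_nat_def add: One_nat_def [symmetric])
qed

end

section \<open>The second order structure given by the splitting \<open>s\<close>\<close>

context quasi_tame_calculus
begin

lemma s_additive: "abelian_group_hom (form_bimodule W \<Omega> 2) T s"
  using s_hom
  by (intro abelian_group_homI' abelian_group_forms forms.MM.abelian_group_tensor)
    (auto simp: bimodule_hom_def left_hom_def)

lemma one_minus_psi_s:
  assumes "X \<in> carrier T"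
  shows "one_minus T (psi_s B W \<Omega> s) X = s (wedge W \<Omega> X)"
proof -
  have "s (wedge W \<Omega> X) \<in> carrier T"
    using abelian_group_hom.hom_closed [OF s_additive] wedge_closed [OF assms] by simp
  then show ?thesis
    using assms by (simp add: one_minus_def psi_s_def forms.MM.T.minus_minus_cancel del: One_nat_def)
qed

text \<open>The value obtained from a lift \<open>X\<close> is \<open>s\<close> applied to
  d(\<pi>(X)), which depends on \<pi>(X) alone, so the set under \<open>the_elem\<close> has at most
  one element. It has one because \<pi> is surjective.\<close>

lemma d_psi_psi_s:
  assumes "\<omega> \<in> \<Omega> 1"
  shows "d_psi B (form_bimodule W \<Omega> 1) d (psi_s B W \<Omega> s) \<omega> = s (d \<omega>)"
proof -
  have "one_minus T (psi_s B W \<Omega> s) (univ_proj2 B (form_bimodule W \<Omega> 1) d (univ_d1 B X))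
      = s (d (univ_proj1 (form_bimodule W \<Omega> 1) d X))" if "X \<in> carrier (univ_forms1 B)" for X
  proof -
    have "X \<in> carrier (alg_tensor B)" using that by simp
    then show ?thesis
      using abelian_group_hom.hom_closed [OF forms.univ_proj2_d1_hom]
      by (simp add: one_minus_psi_s wedge_univ_proj2_d1 del: One_nat_def)
  qed
  moreover obtain X where "X \<in> carrier (univ_forms1 B)" "univ_proj1 (form_bimodule W \<Omega> 1) d X = \<omega>"
    using forms.univ_proj1_surj [of \<omega>] assms by auto
  ultimately have "{one_minus T (psi_s B W \<Omega> s) (univ_proj2 B (form_bimodule W \<Omega> 1) d (univ_d1 B X)) | X.
      X \<in> carrier (univ_forms1 B) \<and> univ_proj1 (form_bimodule W \<Omega> 1) d X = \<omega>} = {s (d \<omega>)}"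
    by blast
  then show ?thesis by (simp add: d_psi_def)
qed

end

theorem theorem4p9:
  fixes B W :: "(complex, 'w) module"
    and \<Omega> :: "nat \<Rightarrow> 'w set"
    and d :: "'w \<Rightarrow> 'w"
    and s nabla :: "'w \<Rightarrow> ('w \<times> 'w \<Rightarrow>\<^sub>0 int) set"
  assumes "quasi_tame_calculus B W \<Omega> d s"
    and "left_connection B (form_bimodule W \<Omega> 1) d nabla"
  shows "(\<forall>\<omega> \<in> \<Omega> 1. wedge W \<Omega> (nabla \<omega>) = d \<omega>) \<longleftrightarrow>
         (\<forall>\<omega> \<in> \<Omega> 1. one_minus (tensor B (form_bimodule W \<Omega> 1) (form_bimodule W \<Omega> 1))
                     (psi_s B W \<Omega> s) (nabla \<omega>)
                   = d_psi B (form_bimodule W \<Omega> 1) d (psi_s B W \<Omega> s) \<omega>)"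
proof -
  interpret quasi_tame_calculus B W \<Omega> d s by (rule assms(1))
  have nabla: "nabla \<omega> \<in> carrier T" if "\<omega> \<in> \<Omega> 1" for \<omega>
    using left_connection.nabla_closed [OF assms(2)] that by auto
  have "inj_on s (\<Omega> 2)"
    by (rule inj_on_inverseI) (rule wedge_s)
  \<comment> \<open>Injectivity is available on \<open>\<Omega> 2\<close>, so both arguments of
    \<open>s\<close> have to be placed there.\<close>
  then have "s (wedge W \<Omega> (nabla \<omega>)) = s (d \<omega>) \<longleftrightarrow> wedge W \<Omega> (nabla \<omega>) = d \<omega>" if "\<omega> \<in> \<Omega> 1" for \<omega>
    using wedge_closed [OF nabla [OF that]] d_degree [OF that]
    by (simp add: inj_on_eq_iff numeral_2_eq_2)
  then show ?thesis
    by (simp add: one_minus_psi_s d_psi_psi_s nabla del: One_nat_def)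
qed

end
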